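(* Let $N$ be a positive integer, let $H \in \mathbb{C}^{N\times N}$ be a self-adjoint matrix, let $S \subseteq \{1,\ldots,N\}$ with complement $\overline{S} = \{1,\ldots,N\}\setminus S$, and write $H$ in block form with respect to $S$ and $\overline{S}$ as $$H = \begin{pmatrix} H_{SS} & H_{S\overline{S}} \\ H_{\overline{S}S} & H_{\overline{S}\,\overline{S}} \end{pmatrix}.$$ For $\lambda \in \mathbb{C}\setminus \sigma(H_{\overline{S}\,\overline{S}})$ let $$R_S(H,\lambda) = H_{SS} + H_{S\overline{S}}\left(\lambda I - H_{\overline{S}\,\overline{S}}\right)^{-1} H_{\overline{S}S}$$ be the isospectral reduction of $H$ to $S$. Let $T$ be a normal and invertible complex $|S|\times|S|$ matrix (with rows and columns indexed by $S$). Then the following are equivalent: (i) $[R_S(H,\lambda), T] = 0$ for all $\lambda \notin \sigma(H_{\overline{S}\,\overline{S}})$. (ii) $[(H^k)_{SS}, T] = 0$ for all $k \in \mathbb{N}$. (iii) There exists a normal matrix $Q \in \mathbb{C}^{N\times N}$ of the form $Q = T \oplus \overline{Q}$ (block-diagonal with respect to $S$ and $\overline{S}$) such that $[Q,H] = 0$.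
   Context: For a matrix $M \in \mathbb{C}^{N\times N}$ and index sets $A,B \subseteq \{1,\ldots,N\}$, $M_{AB}$ denotes the submatrix of $M$ obtained by taking the rows indexed by $A$ and the columns indexed by $B$; in particular $(H^k)_{SS}$ is the $SS$-block of the $k$-th power of $H$. $\sigma(M)$ denotes the eigenvalue spectrum of $M$, $I$ is the identity matrix of the appropriate size, and $[A,B] = AB - BA$ is the commutator. $Q = T \oplus \overline{Q}$ means $Q_{SS} = T$, $Q_{\overline{S}\,\overline{S}} = \overline{Q}$, $Q_{S\overline{S}} = 0$ and $Q_{\overline{S}S} = 0$, where $\overline{Q}$ is some complex $|\overline{S}|\times|\overline{S}|$ matrix (the bar in $\overline{Q}$ is only notation, not complex conjugation). *)

theory Defs
  imports
    "Jordan_Normal_Form.DL_Submatrix"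
    "Jordan_Normal_Form.Gauss_Jordan_Elimination"
    "Jordan_Normal_Form.Schur_Decomposition"
    "Jordan_Normal_Form.Spectral_Radius"
begin

text \<open>
  Row and column indices are 0-based, so index sets are subsets of \<open>{..<N}\<close>.
  The block of a matrix with rows in \<open>A\<close> and columns in \<open>B\<close> is \<open>submatrix M A B\<close>, which
  enumerates \<open>A\<close> and \<open>B\<close> in increasing order; an \<open>S\<close>-indexed square matrix is accordingly
  an element of \<open>carrier_mat (card S) (card S)\<close>, its \<open>i\<close>-th row and column
  belonging to the \<open>i\<close>-th smallest element of \<open>S\<close>.
\<close>

definition self_adjoint_mat :: "complex mat \<Rightarrow> bool" where
  "self_adjoint_mat A \<longleftrightarrow> mat_adjoint A = A"

definition normal_mat :: "complex mat \<Rightarrow> bool" where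
  "normal_mat A \<longleftrightarrow> A * mat_adjoint A = mat_adjoint A * A"

definition mat_commutator :: "complex mat \<Rightarrow> complex mat \<Rightarrow> complex mat" where
  "mat_commutator A B = A * B - B * A"

definition co_index :: "complex mat \<Rightarrow> nat set \<Rightarrow> nat set" where
  "co_index M S = {..<dim_row M} - S"

text \<open>
  The inverse below exists exactly if \<open>\<mu>\<close> is not in the spectrum of the complementary block;
  for other \<open>\<mu>\<close> the value of \<open>isospectral_reduction\<close> is meaningless.
\<close>

definition isospectral_reduction :: "complex mat \<Rightarrow> nat set \<Rightarrow> complex \<Rightarrow> complex mat" where
  "isospectral_reduction H S \<mu> =
    (let S' = co_index H S in
     submatrix H S S +
     submatrix H S S' * the (mat_inverse (\<mu> \<cdot>\<^sub>m 1\<^sub>m (card S') - submatrix H S' S')) * submatrix H S' S)"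

text \<open>\<open>is_direct_sum S Q T Q'\<close> says \<open>Q = T \<oplus> Q'\<close> with respect to \<open>S\<close> and its complement.\<close>

definition is_direct_sum :: "nat set \<Rightarrow> complex mat \<Rightarrow> complex mat \<Rightarrow> complex mat \<Rightarrow> bool" where
  "is_direct_sum S Q T Q' \<longleftrightarrow>
    (let S' = co_index Q S in
     submatrix Q S S = T \<and>
     submatrix Q S' S' = Q' \<and>
     submatrix Q S S' = 0\<^sub>m (card S) (card S') \<and>
     submatrix Q S' S = 0\<^sub>m (card S') (card S))"

end

theory Submission
  imports Defs
begin

text \<open>
  Write \<open>A\<close>, \<open>B\<close>, \<open>C\<close>, \<open>D\<close> for the blocks of \<open>H\<close>, so that \<open>C\<close> is the adjoint of \<open>B\<close> and \<open>D\<close> is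
  self-adjoint. All three conditions are equivalent to a fourth one, which speaks of the
  moments of the complement: \<open>T\<close> commutes with \<open>A\<close> and with every \<open>B D\<^sup>k C\<close>.

  The moments are the coefficients of the expansion of the reduction at \<open>\<mu> = \<infinity>\<close>, but no limit
  is needed to extract them. Take a polynomial that annihilates \<open>D\<close>. Because
  \<open>D (\<mu> - D)\<^sup>-\<^sup>1 = \<mu> (\<mu> - D)\<^sup>-\<^sup>1 - 1\<close>, it turns (i) into a polynomial identity in \<open>\<mu>\<close> that holds at
  infinitely many points; its coefficients form a triangular system in the commutators of \<open>T\<close> with
  \<open>A\<close> and the moments (lemma \<open>resolvent_moments_commute\<close>). The powers of \<open>H\<close> determine the moments
  because a path through the index set that starts in \<open>S\<close> can be cut at its visits to \<open>S\<close>
  (lemma \<open>power_blocks_moments_commute\<close>).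

  Conversely, assume that \<open>T\<close> commutes with \<open>A\<close> and the moments. On the Krylov space
  spanned by the ranges of all \<open>D\<^sup>k C\<close> put \<open>Q' (D\<^sup>k C v) = D\<^sup>k C T v\<close>, and put \<open>Q' = 0\<close> on its
  orthogonal complement. This is well defined, since the inner products of the vectors \<open>D\<^sup>k C v\<close>
  are given by the moments, and \<open>Q'\<close> intertwines everything that (iii) asks for. To avoid
  subspaces, the map is written in closed form: with \<open>L X = \<Sum>\<^sub>k D\<^sup>k C X B D\<^sup>k\<close> and the Gram matrix
  \<open>G = L 1\<close>, whose range is the Krylov space, \<open>Q' = L T P\<close> where \<open>P\<close> is a polynomial in \<open>G\<close>
  with \<open>G P G = G\<close> (lemma \<open>commuting_extension_exists\<close>). Its normality comes from
  \<open>L X L Y = L (X Y) G\<close>, which makes \<open>L T\<close> normal when \<open>T\<close> is.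

  Finally, a matrix \<open>T \<oplus> Q'\<close> that commutes with \<open>H\<close> commutes with all powers of \<open>H\<close>, and
  \<open>Q'\<close> commutes with the resolvent of \<open>D\<close>; this gives (ii) and (i).
\<close>

section \<open>Adjoints, differences and powers\<close>

text \<open>
  Side conditions on dimensions, unlike carrier conditions, can be discharged by rewriting.
\<close>

lemma mult_assoc_dim:
  fixes A :: "'a::semiring_0 mat"
  shows "dim_col A = dim_row B \<Longrightarrow> dim_col B = dim_row C \<Longrightarrow> A * B * C = A * (B * C)"
  by (rule assoc_mult_mat[of A "dim_row A" "dim_row B" B "dim_row C" C "dim_col C"]) auto

lemma dim_mat_adjoint [simp]:
  "dim_row (mat_adjoint A) = dim_col A" "dim_col (mat_adjoint A) = dim_row A"
  unfolding mat_adjoint_def by auto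

lemma mat_adjoint_carrier [simp]:
  "A \<in> carrier_mat nr nc \<Longrightarrow> mat_adjoint A \<in> carrier_mat nc nr"
  by (auto intro!: carrier_matI)

lemma index_mat_adjoint [simp]:
  "i < dim_col A \<Longrightarrow> j < dim_row A \<Longrightarrow> mat_adjoint A $$ (i, j) = conjugate (A $$ (j, i))"
  unfolding mat_adjoint_def by (simp add: mat_of_rows_index)

lemma mat_adjoint_mult:
  fixes A :: "complex mat"
  assumes "dim_col A = dim_row B"
  shows "mat_adjoint (A * B) = mat_adjoint B * mat_adjoint A"
  by (rule eq_matI) (use assms in \<open>auto simp: scalar_prod_def mult.commute\<close>)

lemma mat_adjoint_adjoint [simp]: "mat_adjoint (mat_adjoint A) = (A :: complex mat)"
  by (rule eq_matI) auto

lemma mat_adjoint_one [simp]: "mat_adjoint (1\<^sub>m n) = (1\<^sub>m n :: complex mat)"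
  by (rule eq_matI) auto

lemma mat_adjoint_zero [simp]: "mat_adjoint (0\<^sub>m m n) = (0\<^sub>m n m :: complex mat)"
  by (rule eq_matI) auto

lemma minus_mat_eq_0D:
  fixes A :: "complex mat"
  assumes "A - B = 0\<^sub>m nr nc" "A \<in> carrier_mat nr nc" "B \<in> carrier_mat nr nc"
  shows "A = B"
proof (rule eq_matI)
  fix i j assume ij: "i < dim_row B" "j < dim_col B"
  have "(A - B) $$ (i, j) = 0" using ij assms(3) by (auto simp: assms(1))
  then show "A $$ (i, j) = B $$ (i, j)" using ij by simp
qed (use assms(2,3) in auto)

lemma minus_mat_zero: "A \<in> carrier_mat nr nc \<Longrightarrow> A - 0\<^sub>m nr nc = (A :: complex mat)"
  by (rule eq_matI) auto

lemma minus_minus_mat: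
  "A \<in> carrier_mat nr nc \<Longrightarrow> B \<in> carrier_mat nr nc \<Longrightarrow> A - (A - B) = (B :: complex mat)"
  by (rule eq_matI) auto

lemma pow_mat_add:
  fixes A :: "complex mat"
  assumes "A \<in> carrier_mat n n"
  shows "A ^\<^sub>m (i + j) = A ^\<^sub>m i * A ^\<^sub>m j"
  by (induction j) (use assms in \<open>auto simp: mult_assoc_dim\<close>)

lemma pow_mat_commute:
  fixes A :: "complex mat"
  assumes "A \<in> carrier_mat n n" "Z \<in> carrier_mat n n" "Z * A = A * Z"
  shows "Z * A ^\<^sub>m i = A ^\<^sub>m i * Z"
proof (induction i)
  case (Suc i)
  have "Z * A ^\<^sub>m Suc i = (Z * A ^\<^sub>m i) * A"
    using assms by (simp add: mult_assoc_dim)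
  also have "\<dots> = A ^\<^sub>m i * (Z * A)"
    unfolding Suc using assms(1,2) by (simp add: mult_assoc_dim)
  also have "\<dots> = A ^\<^sub>m Suc i * Z"
    unfolding assms(3) using assms(1,2) by (simp add: mult_assoc_dim)
  finally show ?case .
qed (use assms in auto)

lemma pow_mat_Suc_left:
  fixes A :: "complex mat"
  assumes "A \<in> carrier_mat n n"
  shows "A ^\<^sub>m Suc i = A * A ^\<^sub>m i"
  using pow_mat_commute[OF assms assms] by simp

lemma mat_adjoint_pow:
  fixes A :: "complex mat"
  assumes "A \<in> carrier_mat n n"
  shows "mat_adjoint (A ^\<^sub>m i) = mat_adjoint A ^\<^sub>m i"
proof (induction i)
  case (Suc i)
  have "mat_adjoint (A ^\<^sub>m Suc i) = mat_adjoint A * mat_adjoint A ^\<^sub>m i"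
    using assms Suc by (simp add: mat_adjoint_mult)
  then show ?case
    using pow_mat_Suc_left[of "mat_adjoint A" n i] assms by simp
qed (use assms in auto)

section \<open>Finite sums of matrices\<close>

text \<open>
  The dimensions are arguments because the type of matrices has no neutral element of addition
  to serve as the empty sum.
\<close>

definition mat_sum :: "nat \<Rightarrow> nat \<Rightarrow> (nat \<Rightarrow> complex mat) \<Rightarrow> nat set \<Rightarrow> complex mat" where
  "mat_sum nr nc f I = mat nr nc (\<lambda>ij. \<Sum>k\<in>I. f k $$ ij)"

lemma dim_mat_sum [simp]: "dim_row (mat_sum nr nc f I) = nr" "dim_col (mat_sum nr nc f I) = nc"
  unfolding mat_sum_def by auto

lemma mat_sum_carrier [simp]: "mat_sum nr nc f I \<in> carrier_mat nr nc"
  by (auto intro: carrier_matI)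

lemma index_mat_sum [simp]:
  "i < nr \<Longrightarrow> j < nc \<Longrightarrow> mat_sum nr nc f I $$ (i, j) = (\<Sum>k\<in>I. f k $$ (i, j))"
  unfolding mat_sum_def by simp

lemma mat_sum_cong:
  "(\<And>k. k \<in> I \<Longrightarrow> f k = g k) \<Longrightarrow> mat_sum nr nc f I = mat_sum nr nc g I"
  unfolding mat_sum_def by (intro cong_mat refl sum.cong) auto

lemma mat_sum_zero: "(\<And>k. k \<in> I \<Longrightarrow> f k = 0\<^sub>m nr nc) \<Longrightarrow> mat_sum nr nc f I = 0\<^sub>m nr nc"
  by (rule eq_matI) auto

lemma mult_mat_sum:
  assumes "X \<in> carrier_mat p nr" "\<And>k. k \<in> I \<Longrightarrow> f k \<in> carrier_mat nr nc"
  shows "X * mat_sum nr nc f I = mat_sum p nc (\<lambda>k. X * f k) I"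
proof (rule eq_matI)
  fix i j assume ij: "i < dim_row (mat_sum p nc (\<lambda>k. X * f k) I)" "j < dim_col (mat_sum p nc (\<lambda>k. X * f k) I)"
  have "(X * mat_sum nr nc f I) $$ (i, j) = (\<Sum>l<nr. \<Sum>k\<in>I. X $$ (i, l) * f k $$ (l, j))"
    using ij assms by (simp add: scalar_prod_def sum_distrib_left atLeast0LessThan)
  also have "\<dots> = (\<Sum>k\<in>I. \<Sum>l<nr. X $$ (i, l) * f k $$ (l, j))"
    by (rule sum.swap)
  also have "\<dots> = (\<Sum>k\<in>I. (X * f k) $$ (i, j))"
    using ij assms(1) by (intro sum.cong refl)
      (auto dest!: assms(2) simp: scalar_prod_def atLeast0LessThan)
  finally show "(X * mat_sum nr nc f I) $$ (i, j) = mat_sum p nc (\<lambda>k. X * f k) I $$ (i, j)"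
    using ij by simp
qed (use assms in auto)

lemma mat_sum_mult:
  assumes "X \<in> carrier_mat nc p" "\<And>k. k \<in> I \<Longrightarrow> f k \<in> carrier_mat nr nc"
  shows "mat_sum nr nc f I * X = mat_sum nr p (\<lambda>k. f k * X) I"
proof (rule eq_matI)
  fix i j assume ij: "i < dim_row (mat_sum nr p (\<lambda>k. f k * X) I)" "j < dim_col (mat_sum nr p (\<lambda>k. f k * X) I)"
  have "(mat_sum nr nc f I * X) $$ (i, j) = (\<Sum>l<nc. \<Sum>k\<in>I. f k $$ (i, l) * X $$ (l, j))"
    using ij assms by (simp add: scalar_prod_def sum_distrib_right atLeast0LessThan)
  also have "\<dots> = (\<Sum>k\<in>I. \<Sum>l<nc. f k $$ (i, l) * X $$ (l, j))"
    by (rule sum.swap)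
  also have "\<dots> = (\<Sum>k\<in>I. (f k * X) $$ (i, j))"
    using ij assms(1) by (intro sum.cong refl)
      (auto dest!: assms(2) simp: scalar_prod_def atLeast0LessThan)
  finally show "(mat_sum nr nc f I * X) $$ (i, j) = mat_sum nr p (\<lambda>k. f k * X) I $$ (i, j)"
    using ij by simp
qed (use assms in auto)

lemma mat_adjoint_mat_sum:
  assumes "\<And>k. k \<in> I \<Longrightarrow> f k \<in> carrier_mat nr nc"
  shows "mat_adjoint (mat_sum nr nc f I) = mat_sum nc nr (\<lambda>k. mat_adjoint (f k)) I"
  by (rule eq_matI) (auto intro!: sum.cong dest!: assms)

text \<open>
  The diagonal entries of the sum are sums of squared absolute values, so none of them can cancel.
  This is where positivity enters the proof.
\<close>

lemma sum_adjoint_mult_self_eq_0: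
  assumes "finite I" "\<And>k. k \<in> I \<Longrightarrow> f k \<in> carrier_mat p n"
    and "mat_sum n n (\<lambda>k. mat_adjoint (f k) * f k) I = 0\<^sub>m n n" and "k \<in> I"
  shows "f k = 0\<^sub>m p n"
proof (rule eq_matI)
  fix i j assume ij: "i < dim_row (0\<^sub>m p n :: complex mat)" "j < dim_col (0\<^sub>m p n :: complex mat)"
  have "(\<Sum>k\<in>I. \<Sum>l<p. cnj (f k $$ (l, j)) * f k $$ (l, j))
      = mat_sum n n (\<lambda>k. mat_adjoint (f k) * f k) I $$ (j, j)"
    using ij by (auto intro!: sum.cong dest!: assms(2) simp: scalar_prod_def atLeast0LessThan)
  also have "\<dots> = 0"
    using ij assms(3) by simp
  finally have "complex_of_real (\<Sum>k\<in>I. \<Sum>l<p. (cmod (f k $$ (l, j)))\<^sup>2) = 0"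
    by (simp add: complex_norm_square mult.commute del: of_real_power)
  then have "(\<Sum>k\<in>I. \<Sum>l<p. (cmod (f k $$ (l, j)))\<^sup>2) = 0"
    using of_real_eq_0_iff by blast
  then have "(\<Sum>l<p. (cmod (f k $$ (l, j)))\<^sup>2) = 0"
    using assms(1,4) by (subst (asm) sum_nonneg_eq_0_iff) (auto intro: sum_nonneg)
  then show "f k $$ (i, j) = 0\<^sub>m p n $$ (i, j)"
    using ij by (subst (asm) sum_nonneg_eq_0_iff) auto
qed (use assms(2,4) in auto)

lemma adjoint_mult_self_eq_0:
  fixes X :: "complex mat"
  assumes "X \<in> carrier_mat p n" "mat_adjoint X * X = 0\<^sub>m n n"
  shows "X = 0\<^sub>m p n"
proof (rule sum_adjoint_mult_self_eq_0[of "{0::nat}" "\<lambda>_. X" p n 0])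
  show "mat_sum n n (\<lambda>k. mat_adjoint X * X) {0::nat} = 0\<^sub>m n n"
    by (rule eq_matI) (simp_all add: assms(2))
qed (use assms in auto)

section \<open>Annihilating polynomials and generalized inverses\<close>

text \<open>
  The powers of \<open>M\<close> lie in a space of dimension \<open>n\<^sup>2\<close>, so the first \<open>n\<^sup>2 + 1\<close> of them are linearly
  dependent. The leading coefficient of the dependence is kept different from \<open>0\<close>.
\<close>

lemma annihilating_coefficients:
  fixes M :: "complex mat"
  assumes M: "M \<in> carrier_mat n n"
  obtains m c where "c m \<noteq> 0" "mat_sum n n (\<lambda>i. c i \<cdot>\<^sub>m M ^\<^sub>m i) {..m} = 0\<^sub>m n n"
proof -
  let ?d = "Suc (n * n)"
  \<comment> \<open>Column \<open>i\<close> lists the entries of the \<open>i\<close>-th power; the additional last row is \<open>0\<close>,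
  so the determinant vanishes and a kernel vector is a linear dependence.\<close>
  define Z where "Z = mat ?d ?d (\<lambda>(r, i). if r < n * n then (M ^\<^sub>m i) $$ (r div n, r mod n) else 0)"
  have Z: "Z \<in> carrier_mat ?d ?d" by (simp add: Z_def)
  have "det Z = 0"
  proof -
    have "det Z = (\<Sum>j<?d. Z $$ (n * n, j) * cofactor Z (n * n) j)"
      by (rule laplace_expansion_row[OF Z]) simp
    also have "\<dots> = 0" by (intro sum.neutral) (simp add: Z_def)
    finally show ?thesis .
  qed
  then obtain v where v: "v \<in> carrier_vec ?d" "v \<noteq> 0\<^sub>v ?d" and Zv: "Z *\<^sub>v v = 0\<^sub>v ?d"
    using det_0_iff_vec_prod_zero[OF Z] by auto
  define J where "J = {i. i < ?d \<and> v $ i \<noteq> 0}"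
  have "finite J" unfolding J_def by simp
  have "J \<noteq> {}" using v unfolding J_def by (auto simp: vec_eq_iff)
  define m where "m = Max J"
  have mJ: "m \<in> J" unfolding m_def using \<open>finite J\<close> \<open>J \<noteq> {}\<close> by simp
  have above: "v $ i = 0" if "i < ?d" "m < i" for i
  proof (rule ccontr)
    assume "v $ i \<noteq> 0"
    then have "i \<in> J" using that(1) by (simp add: J_def)
    then have "i \<le> m" unfolding m_def using \<open>finite J\<close> by (rule Max_ge[rotated])
    then show False using that(2) by simp
  qed
  have "(\<Sum>i\<le>m. v $ i * (M ^\<^sub>m i) $$ (a, b)) = 0" if ab: "a < n" "b < n" for a b
  proof -
    let ?r = "a * n + b"
    have "?r < Suc a * n" using ab by simp
    also have "\<dots> \<le> n * n" using ab by (intro mult_le_mono1) simp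
    finally have r: "?r < n * n" .
    have dm: "?r div n = a" "?r mod n = b" using ab by auto
    have "0 = (Z *\<^sub>v v) $ ?r" using Zv r by simp
    also have "\<dots> = (\<Sum>i<?d. v $ i * (M ^\<^sub>m i) $$ (a, b))"
      using r v(1) dm Z by (auto simp: scalar_prod_def atLeast0LessThan Z_def mult.commute intro!: sum.cong simp del: sum.lessThan_Suc)
    also have "\<dots> = (\<Sum>i\<le>m. v $ i * (M ^\<^sub>m i) $$ (a, b))"
      using mJ above by (intro sum.mono_neutral_right) (auto simp: J_def simp del: sum.lessThan_Suc)
    finally show ?thesis by simp
  qed
  then have "mat_sum n n (\<lambda>i. v $ i \<cdot>\<^sub>m M ^\<^sub>m i) {..m} = 0\<^sub>m n n"
    using M by (intro eq_matI) auto
  moreover have "v $ m \<noteq> 0" using mJ by (simp add: J_def)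
  ultimately show thesis by (rule that[rotated])
qed

text \<open>
  If \<open>G\<^sup>k\<^sup>+\<^sup>1 Y = 0\<close> with \<open>k \<ge> 1\<close>, then \<open>G\<^sup>k Y\<close> has Gram matrix \<open>Y\<^sup>* G\<^sup>k\<^sup>-\<^sup>1 G\<^sup>k\<^sup>+\<^sup>1 Y = 0\<close>. Hence a Hermitian
  matrix has no nontrivial Jordan block at \<open>0\<close>, without any diagonalization.
\<close>

lemma hermitian_pow_mult_eq_0:
  fixes G :: "complex mat"
  assumes G: "G \<in> carrier_mat n n" "mat_adjoint G = G" and Y: "Y \<in> carrier_mat n p"
    and "G ^\<^sub>m k * Y = 0\<^sub>m n p"
  shows "G * Y = 0\<^sub>m n p"
  using assms(4)
proof (induction k)
  case 0
  then have "Y = 0\<^sub>m n p" using G(1) Y by simp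
  then show ?case using G(1) by simp
next
  case (Suc k)
  show ?case
  proof (cases k)
    case 0
    then show ?thesis using Suc.prems G(1) by simp
  next
    case (Suc j)
    note k = this
    have GY: "G ^\<^sub>m k * Y \<in> carrier_mat n p"
      using mult_carrier_mat[OF pow_carrier_mat[OF G(1)] Y] .
    have "G ^\<^sub>m k * G ^\<^sub>m k = G ^\<^sub>m j * G ^\<^sub>m Suc k"
      unfolding pow_mat_add[OF G(1), symmetric] by (simp add: k del: pow_mat.simps)
    then have "G ^\<^sub>m k * (G ^\<^sub>m k * Y) = G ^\<^sub>m j * (G ^\<^sub>m Suc k * Y)"
      using assoc_mult_mat[OF pow_carrier_mat[OF G(1)] pow_carrier_mat[OF G(1)] Y] by metis
    also have "\<dots> = 0\<^sub>m n p"
      unfolding Suc.prems by (rule right_mult_zero_mat[OF pow_carrier_mat[OF G(1)]])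
    finally have GGY: "G ^\<^sub>m k * (G ^\<^sub>m k * Y) = 0\<^sub>m n p" .
    have "mat_adjoint (G ^\<^sub>m k * Y) = mat_adjoint Y * G ^\<^sub>m k"
      using G Y by (simp add: mat_adjoint_mult mat_adjoint_pow)
    then have "mat_adjoint (G ^\<^sub>m k * Y) * (G ^\<^sub>m k * Y) = mat_adjoint Y * (G ^\<^sub>m k * (G ^\<^sub>m k * Y))"
      using assoc_mult_mat[OF mat_adjoint_carrier[OF Y] pow_carrier_mat[OF G(1)] GY] by simp
    also have "\<dots> = 0\<^sub>m p p"
      unfolding GGY by (rule right_mult_zero_mat[OF mat_adjoint_carrier[OF Y]])
    finally have "G ^\<^sub>m k * Y = 0\<^sub>m n p"
      by (rule adjoint_mult_self_eq_0[OF GY])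
    then show ?thesis by (rule Suc.IH)
  qed
qed

text \<open>
  Divide an annihilating polynomial of \<open>G\<close> by its lowest nonzero coefficient, at exponent \<open>k\<close>. The result
  has the form \<open>G\<^sup>k (1 - G P) = 0\<close> with \<open>P\<close> a polynomial in \<open>G\<close>, and for Hermitian \<open>G\<close> the exponent
  can be lowered to \<open>1\<close>. Only one property of polynomials in \<open>G\<close> is recorded: \<open>P\<close> commutes
  with whatever commutes with \<open>G\<close>.
\<close>

lemma hermitian_generalized_inverse:
  fixes G :: "complex mat"
  assumes G: "G \<in> carrier_mat n n" "mat_adjoint G = G"
  obtains P where "P \<in> carrier_mat n n" "G * P * G = G"
    and "\<And>Z. Z \<in> carrier_mat n n \<Longrightarrow> Z * G = G * Z \<Longrightarrow> Z * P = P * Z"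
proof -
  obtain m c where cm: "c m \<noteq> 0" and ann: "mat_sum n n (\<lambda>i. c i \<cdot>\<^sub>m G ^\<^sub>m i) {..m} = 0\<^sub>m n n"
    using annihilating_coefficients[OF G(1)] by blast
  define k where "k = (LEAST i. c i \<noteq> 0)"
  have ck: "c k \<noteq> 0" unfolding k_def using cm by (rule LeastI)
  have low: "c i = 0" if "i < k" for i using not_less_Least that unfolding k_def by blast
  have km: "k \<le> m" unfolding k_def using cm by (rule Least_le)
  define P where "P = mat_sum n n (\<lambda>i. (- c (i + Suc k) / c k) \<cdot>\<^sub>m G ^\<^sub>m i) {..<m - k}"
  have P: "P \<in> carrier_mat n n" by (simp add: P_def)
  have com: "Z * P = P * Z" if Z: "Z \<in> carrier_mat n n" "Z * G = G * Z" for Z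
  proof -
    have "Z * ((- c (i + Suc k) / c k) \<cdot>\<^sub>m G ^\<^sub>m i) = ((- c (i + Suc k) / c k) \<cdot>\<^sub>m G ^\<^sub>m i) * Z" for i
      using mult_smult_distrib[OF Z(1) pow_carrier_mat[OF G(1)]]
        mult_smult_assoc_mat[OF pow_carrier_mat[OF G(1)] Z(1)] pow_mat_commute[OF G(1) Z] by simp
    then show ?thesis
      unfolding P_def using G(1) Z(1) by (simp add: mult_mat_sum[where nr=n] mat_sum_mult[where nc=n])
  qed
  have "G ^\<^sub>m k * (1\<^sub>m n - G * P) = 0\<^sub>m n n"
  proof -
    have "G ^\<^sub>m k * (1\<^sub>m n - G * P) = G ^\<^sub>m k - G ^\<^sub>m Suc k * P"
      using G(1) P by (subst mult_minus_distrib_mat) (auto simp: mult_assoc_dim)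
    also have "G ^\<^sub>m Suc k * P = mat_sum n n (\<lambda>i. (- c (i + Suc k) / c k) \<cdot>\<^sub>m G ^\<^sub>m (i + Suc k)) {..<m - k}"
      unfolding P_def
    proof (subst mult_mat_sum[where nr=n])
      show "mat_sum n n (\<lambda>i. G ^\<^sub>m Suc k * ((- c (i + Suc k) / c k) \<cdot>\<^sub>m G ^\<^sub>m i)) {..<m - k} =
         mat_sum n n (\<lambda>i. (- c (i + Suc k) / c k) \<cdot>\<^sub>m G ^\<^sub>m (i + Suc k)) {..<m - k}"
        using G(1) by (intro mat_sum_cong)
          (simp add: mult_smult_distrib[OF pow_carrier_mat[OF G(1)] pow_carrier_mat[OF G(1)]]
             pow_mat_add[OF G(1), symmetric] add.commute del: pow_mat.simps)
    qed (use G(1) in auto)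
    also have "G ^\<^sub>m k - \<dots> = 0\<^sub>m n n"
    proof (rule eq_matI)
      fix a b assume "a < dim_row (0\<^sub>m n n :: complex mat)" "b < dim_col (0\<^sub>m n n :: complex mat)"
      then have ab: "a < n" "b < n" by auto
      define g where "g i = (G ^\<^sub>m i) $$ (a, b)" for i
      have "0 = (\<Sum>i\<le>m. c i * g i)"
        using arg_cong[OF ann, of "\<lambda>M. M $$ (a, b)"] ab G(1) by (simp add: g_def)
      also have "\<dots> = (\<Sum>i\<in>{k..m}. c i * g i)"
        by (rule sum.mono_neutral_right) (use low in auto)
      also have "\<dots> = c k * g k + (\<Sum>i\<in>{Suc k..m}. c i * g i)"
        using km by (simp add: sum.atLeast_Suc_atMost)
      also have "(\<Sum>i\<in>{Suc k..m}. c i * g i) = (\<Sum>i<m - k. c (i + Suc k) * g (i + Suc k))"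
        by (rule sum.reindex_bij_witness[of _ "\<lambda>i. i + Suc k" "\<lambda>i. i - Suc k"]) (use km in auto)
      finally have "g k + (\<Sum>i<m - k. c (i + Suc k) * g (i + Suc k)) / c k = 0"
        using ck by (simp add: field_simps)
      then show "(G ^\<^sub>m k - mat_sum n n (\<lambda>i. (- c (i + Suc k) / c k) \<cdot>\<^sub>m G ^\<^sub>m (i + Suc k)) {..<m - k}) $$ (a, b)
           = 0\<^sub>m n n $$ (a, b)"
        using ab G(1) by (simp add: g_def sum_divide_distrib sum_negf del: pow_mat.simps)
    qed (use G(1) in auto)
    finally show ?thesis .
  qed
  then have "G * (1\<^sub>m n - G * P) = 0\<^sub>m n n"
    using G P by (intro hermitian_pow_mult_eq_0[of G n _ n k]) auto
  then have "G - G * (G * P) = 0\<^sub>m n n"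
    using G(1) P by (simp add: mult_minus_distrib_mat[of G n n _ n])
  then have "G = G * (G * P)"
    by (rule minus_mat_eq_0D) (use G(1) P in auto)
  also have "\<dots> = G * (P * G)"
    by (rule arg_cong[OF com[OF G(1) refl]])
  also have "\<dots> = G * P * G"
    using G(1) P by (intro assoc_mult_mat[symmetric])
  finally have "G * P * G = G" by (rule sym)
  then show thesis
    using that[of P] P com by blast
qed

section \<open>Linear recurrences of moments\<close>

text \<open>
  An annihilating polynomial of \<open>D\<close> gives one linear recurrence that the entries of
  \<open>X D\<^sup>k Y\<close> satisfy for all \<open>X\<close> and \<open>Y\<close> at once.
\<close>

lemma power_recurrence:
  fixes D :: "complex mat"
  assumes D: "D \<in> carrier_mat n n"
  obtains c m where "c m \<noteq> 0"
    and "\<And>X Y p q a b k. X \<in> carrier_mat p n \<Longrightarrow> Y \<in> carrier_mat n q \<Longrightarrow> a < p \<Longrightarrow> b < q \<Longrightarrow>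
           (\<Sum>i\<le>m. c i * (X * D ^\<^sub>m (k + i) * Y) $$ (a, b)) = 0"
proof -
  obtain m c where cm: "c m \<noteq> 0" and ann: "mat_sum n n (\<lambda>i. c i \<cdot>\<^sub>m D ^\<^sub>m i) {..m} = 0\<^sub>m n n"
    using annihilating_coefficients[OF D] by blast
  have rec: "(\<Sum>i\<le>m. c i * (V * D ^\<^sub>m i * Y) $$ (a, b)) = 0"
    if V: "V \<in> carrier_mat p n" and Y: "Y \<in> carrier_mat n q" and ab: "a < p" "b < q" for V Y p q a b
  proof -
    have "V * mat_sum n n (\<lambda>i. c i \<cdot>\<^sub>m D ^\<^sub>m i) {..m} * Y = mat_sum p n (\<lambda>i. V * (c i \<cdot>\<^sub>m D ^\<^sub>m i)) {..m} * Y"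
      using D by (subst mult_mat_sum[OF V]) auto
    also have "\<dots> = mat_sum p q (\<lambda>i. V * (c i \<cdot>\<^sub>m D ^\<^sub>m i) * Y) {..m}"
      by (rule mat_sum_mult[OF Y]) (use V D in auto)
    also have "\<dots> = mat_sum p q (\<lambda>i. c i \<cdot>\<^sub>m (V * D ^\<^sub>m i * Y)) {..m}"
    proof (rule mat_sum_cong)
      fix i
      have VD: "V * D ^\<^sub>m i \<in> carrier_mat p n" using V D by auto
      show "V * (c i \<cdot>\<^sub>m D ^\<^sub>m i) * Y = c i \<cdot>\<^sub>m (V * D ^\<^sub>m i * Y)"
        unfolding mult_smult_distrib[OF V pow_carrier_mat[OF D]] by (rule mult_smult_assoc_mat[OF VD Y])
    qed
    finally have "mat_sum p q (\<lambda>i. c i \<cdot>\<^sub>m (V * D ^\<^sub>m i * Y)) {..m} = V * 0\<^sub>m n n * Y"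
      unfolding ann by (rule sym)
    also have "\<dots> = 0\<^sub>m p q"
      unfolding right_mult_zero_mat[OF V] by (rule left_mult_zero_mat[OF Y])
    finally have z: "mat_sum p q (\<lambda>i. c i \<cdot>\<^sub>m (V * D ^\<^sub>m i * Y)) {..m} = 0\<^sub>m p q" .
    from arg_cong[OF z, of "\<lambda>M. M $$ (a, b)"] show ?thesis
      using ab V Y by simp
  qed
  show thesis
  proof (rule that[where c=c and m=m, OF cm])
    fix X Y :: "complex mat" and p q a b k :: nat
    assume X: "X \<in> carrier_mat p n" and Y: "Y \<in> carrier_mat n q" and ab: "a < p" "b < q"
    have "X * D ^\<^sub>m k * D ^\<^sub>m i = X * D ^\<^sub>m (k + i)" for i
      unfolding pow_mat_add[OF D] by (rule assoc_mult_mat[OF X pow_carrier_mat[OF D] pow_carrier_mat[OF D]])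
    then show "(\<Sum>i\<le>m. c i * (X * D ^\<^sub>m (k + i) * Y) $$ (a, b)) = 0"
      using rec[OF mult_carrier_mat[OF X pow_carrier_mat[OF D, of k]] Y ab] by simp
  qed
qed

lemma linear_recurrence_eq_0:
  fixes c g :: "nat \<Rightarrow> complex"
  assumes "c m \<noteq> 0" and rec: "\<And>k. (\<Sum>i\<le>m. c i * g (k + i)) = 0" and init: "\<And>k. k < m \<Longrightarrow> g k = 0"
  shows "g k = 0"
proof (induction k rule: less_induct)
  case (less k)
  show ?case
  proof (cases "k < m")
    case False
    have "0 = (\<Sum>i\<le>m. c i * g (k - m + i))" using rec by simp
    also have "\<dots> = c m * g k + (\<Sum>i<m. c i * g (k - m + i))"
      using False by (simp add: lessThan_Suc_atMost[symmetric] add.commute)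
    also have "(\<Sum>i<m. c i * g (k - m + i)) = 0"
      using False by (intro sum.neutral) (auto intro!: less)
    finally show ?thesis using assms(1) by simp
  qed (use init in auto)
qed

text \<open>
  The coefficient of \<open>\<mu>\<^sup>m\<^sup>-\<^sup>k\<close> is \<open>c m * F k\<close> plus a combination of the \<open>F l\<close> with \<open>l < k\<close>; so the
  system that results from comparing coefficients is triangular.
\<close>

lemma vanishing_polynomial_identity:
  fixes c F :: "nat \<Rightarrow> complex"
  assumes c: "c m \<noteq> 0" and inf: "infinite U"
    and van: "\<And>\<mu>. \<mu> \<in> U \<Longrightarrow> (\<Sum>j\<le>m. c j * (\<Sum>i\<le>j. F (j - i) * \<mu> ^ i)) = 0"
    and "k \<le> m"
  shows "F k = 0"
proof -
  let ?e = "\<lambda>i. \<Sum>j\<in>{i..m}. c j * F (j - i)"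
  have e0: "?e i = 0" if "i \<le> m" for i
  proof -
    have "poly (\<Sum>i\<le>m. monom (?e i) i) \<mu> = 0" if "\<mu> \<in> U" for \<mu>
    proof -
      have "poly (\<Sum>i\<le>m. monom (?e i) i) \<mu> = (\<Sum>i\<le>m. \<Sum>j\<in>{i..m}. c j * (F (j - i) * \<mu> ^ i))"
        by (simp add: poly_sum poly_monom sum_distrib_right mult.assoc)
      also have "\<dots> = (\<Sum>j\<le>m. \<Sum>i\<le>j. c j * (F (j - i) * \<mu> ^ i))"
        by (subst (1 2) sum.Sigma) (auto intro!: sum.reindex_bij_witness[of _ prod.swap prod.swap])
      also have "\<dots> = 0" using van[OF that] by (simp add: sum_distrib_left)
      finally show ?thesis .
    qed
    then have "U \<subseteq> {\<mu>. poly (\<Sum>i\<le>m. monom (?e i) i) \<mu> = 0}" by auto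
    then have "(\<Sum>i\<le>m. monom (?e i) i) = 0"
      using inf poly_roots_finite finite_subset by blast
    then have "coeff (\<Sum>i\<le>m. monom (?e i) i) i = 0" by simp
    then show ?thesis using that by (simp add: coeff_sum)
  qed
  show ?thesis using \<open>k \<le> m\<close>
  proof (induction k rule: less_induct)
    case (less k)
    have "0 = ?e (m - k)" using e0 by simp
    also have "\<dots> = (\<Sum>j\<in>{m}. c j * F (j - (m - k)))"
      using less by (intro sum.mono_neutral_right) (auto intro!: less.IH)
    finally show ?case using c less.prems by simp
  qed
qed

text \<open>
  A finite number of powers suffices to test that \<open>X\<close> annihilates the Krylov space of \<open>Y\<close>. The
  number \<open>m\<close> depends on \<open>D\<close> only; it bounds the sum that defines the Gram matrix below.
\<close>

lemma krylov_zero_from_initial_powers: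
  fixes D :: "complex mat"
  assumes D: "D \<in> carrier_mat n n"
  shows "\<exists>m. \<forall>p q. \<forall>X\<in>carrier_mat p n. \<forall>Y\<in>carrier_mat n q.
           (\<forall>j<m. X * D ^\<^sub>m j * Y = 0\<^sub>m p q) \<longrightarrow> (\<forall>k. X * D ^\<^sub>m k * Y = 0\<^sub>m p q)"
proof (rule power_recurrence[OF D])
  fix c m
  assume c: "c m \<noteq> 0"
    and rec: "\<And>X Y p q a b k. X \<in> carrier_mat p n \<Longrightarrow> Y \<in> carrier_mat n q \<Longrightarrow> a < p \<Longrightarrow> b < q \<Longrightarrow>
           (\<Sum>i\<le>m. c i * (X * D ^\<^sub>m (k + i) * Y) $$ (a, b)) = 0"
  show ?thesis
  proof (intro exI[of _ m] allI ballI impI)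
    fix p q X Y k
    assume X: "X \<in> carrier_mat p n" and Y: "Y \<in> carrier_mat n q"
      and z: "\<forall>j<m. X * D ^\<^sub>m j * Y = 0\<^sub>m p q"
    have "(X * D ^\<^sub>m k * Y) $$ (a, b) = 0" if "a < p" "b < q" for a b
      by (rule linear_recurrence_eq_0[of c m "\<lambda>k. (X * D ^\<^sub>m k * Y) $$ (a, b)", OF c])
        (use rec[OF X Y that] z that in auto)
    then show "X * D ^\<^sub>m k * Y = 0\<^sub>m p q"
      using X Y by (intro eq_matI) auto
  qed
qed

section \<open>Recovering the moments\<close>

lemma mat_commutator_eq_0_iff:
  assumes "A \<in> carrier_mat n n" "B \<in> carrier_mat n n"
  shows "mat_commutator A B = 0\<^sub>m n n \<longleftrightarrow> A * B = B * A"
proof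
  assume "mat_commutator A B = 0\<^sub>m n n"
  then show "A * B = B * A"
    unfolding mat_commutator_def by (rule minus_mat_eq_0D) (use assms in auto)
next
  assume "A * B = B * A"
  then show "mat_commutator A B = 0\<^sub>m n n"
    unfolding mat_commutator_def using minus_r_inv_mat[OF mult_carrier_mat[OF assms(2,1)]] by simp
qed

lemma index_smult_minus_mat:
  "V \<in> carrier_mat p q \<Longrightarrow> W \<in> carrier_mat p q \<Longrightarrow> a < p \<Longrightarrow> b < q \<Longrightarrow>
   (\<mu> \<cdot>\<^sub>m V - W) $$ (a, b) = \<mu> * V $$ (a, b) - (W $$ (a, b) :: complex)"
  by auto

text \<open>
  Fix an entry of the commutators with \<open>T\<close>. Let \<open>F 0\<close> be that entry for \<open>A\<close>, let \<open>F (k + 1)\<close> be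
  that for \<open>B D\<^sup>k C\<close>, and let \<open>h j\<close> be that for \<open>B D\<^sup>j R C\<close>, where \<open>R\<close> is the resolvent at \<open>\<mu>\<close>. The
  resolvent equation says \<open>h (j + 1) = \<mu> h j - F (j + 1)\<close>, and the hypothesis says \<open>h 0 = - F 0\<close>. So
  \<open>h j\<close> is an explicit polynomial in \<open>\<mu>\<close> with coefficients \<open>- F i\<close>, and the recurrence
  \<open>\<Sum>\<^sub>j c j * h j = 0\<close> becomes a polynomial identity valid on the infinite set \<open>U\<close>.
\<close>

lemma resolvent_moments_commute:
  fixes A B C D T :: "complex mat"
  assumes A: "A \<in> carrier_mat s s" and B: "B \<in> carrier_mat s n" and C: "C \<in> carrier_mat n s"
    and D: "D \<in> carrier_mat n n" and T: "T \<in> carrier_mat s s" and U: "infinite U"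
    and resolvent: "\<And>\<mu>. \<mu> \<in> U \<Longrightarrow> R \<mu> \<in> carrier_mat n n \<and> D * R \<mu> = \<mu> \<cdot>\<^sub>m R \<mu> - 1\<^sub>m n"
    and com: "\<And>\<mu>. \<mu> \<in> U \<Longrightarrow> (A + B * R \<mu> * C) * T = T * (A + B * R \<mu> * C)"
  shows "A * T = T * A" "B * D ^\<^sub>m k * C * T = T * (B * D ^\<^sub>m k * C)"
proof -
  obtain c m where cm: "c m \<noteq> (0::complex)"
    and rec: "\<forall>X p Y q a b k. X \<in> carrier_mat p n \<longrightarrow> Y \<in> carrier_mat n q \<longrightarrow> a < p \<longrightarrow> b < q \<longrightarrow>
           (\<Sum>i\<le>m. c i * (X * D ^\<^sub>m (k + i) * Y) $$ (a, b)) = 0"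
    by (rule power_recurrence[OF D]) blast
  have TB: "T * B \<in> carrier_mat s n" using T B by simp
  have zero: "(A * T) $$ (a, b) - (T * A) $$ (a, b) = 0 \<and>
      (B * D ^\<^sub>m k * (C * T)) $$ (a, b) - (T * B * D ^\<^sub>m k * C) $$ (a, b) = 0"
    if ab: "a < s" "b < s" for a b k
  proof -
    \<comment> \<open>For \<open>Y = R \<mu> * C\<close> this is \<open>h j\<close>, and for \<open>Y = C\<close> it is \<open>F (j + 1)\<close>. The two terms are kept
    apart since each of them has the form covered by the recurrence.\<close>
    define \<psi> where "\<psi> Y j = (B * D ^\<^sub>m j * (Y * T)) $$ (a, b) - (T * B * D ^\<^sub>m j * Y) $$ (a, b)" for Y j
    have \<psi>rec: "(\<Sum>i\<le>m. c i * \<psi> Y (k + i)) = 0" if Y: "Y \<in> carrier_mat n s" for Y k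
    proof -
      have "Y * T \<in> carrier_mat n s" using Y T by simp
      then have "(\<Sum>i\<le>m. c i * (B * D ^\<^sub>m (k + i) * (Y * T)) $$ (a, b)) = 0"
        "(\<Sum>i\<le>m. c i * (T * B * D ^\<^sub>m (k + i) * Y) $$ (a, b)) = 0"
        using rec B TB Y ab by blast+
      then show ?thesis by (simp add: \<psi>_def right_diff_distrib sum_subtractf)
    qed
    define F where "F k = (case k of 0 \<Rightarrow> (A * T) $$ (a, b) - (T * A) $$ (a, b) | Suc j \<Rightarrow> \<psi> C j)" for k
    have van: "(\<Sum>j\<le>m. c j * (\<Sum>i\<le>j. F (j - i) * \<mu> ^ i)) = 0" if \<mu>: "\<mu> \<in> U" for \<mu>
    proof -
      have R: "R \<mu> \<in> carrier_mat n n" and DR: "D * R \<mu> = \<mu> \<cdot>\<^sub>m R \<mu> - 1\<^sub>m n"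
        using resolvent[OF \<mu>] by auto
      define Y where "Y = R \<mu> * C"
      have Y: "Y \<in> carrier_mat n s" using R C by (simp add: Y_def)
      have DY: "D * Y = \<mu> \<cdot>\<^sub>m Y - C"
      proof -
        have "D * Y = D * R \<mu> * C" unfolding Y_def by (rule assoc_mult_mat[symmetric, OF D R C])
        also have "\<dots> = \<mu> \<cdot>\<^sub>m R \<mu> * C - 1\<^sub>m n * C"
          unfolding DR by (rule minus_mult_distrib_mat[OF _ _ C]) (use R in auto)
        also have "\<dots> = \<mu> \<cdot>\<^sub>m Y - C"
          unfolding Y_def mult_smult_assoc_mat[OF R C] left_mult_one_mat[OF C] ..
        finally show ?thesis .
      qed
      have lin: "(X * D ^\<^sub>m Suc j * (Y * Z)) $$ (a, b)
          = \<mu> * (X * D ^\<^sub>m j * (Y * Z)) $$ (a, b) - (X * D ^\<^sub>m j * (C * Z)) $$ (a, b)"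
        if X: "X \<in> carrier_mat s n" and Z: "Z \<in> carrier_mat s s" for X Z j
      proof -
        have XD: "X * D ^\<^sub>m j \<in> carrier_mat s n" using X D by (meson mult_carrier_mat pow_carrier_mat)
        have YZ: "Y * Z \<in> carrier_mat n s" and CZ: "C * Z \<in> carrier_mat n s"
          using Y C Z by (meson mult_carrier_mat)+
        have "D * (Y * Z) = D * Y * Z" by (rule assoc_mult_mat[symmetric, OF D Y Z])
        also have "\<dots> = \<mu> \<cdot>\<^sub>m (Y * Z) - C * Z"
          unfolding DY by (subst minus_mult_distrib_mat[OF _ C Z])
            (use Y Z in \<open>auto simp: mult_smult_assoc_mat[OF Y Z]\<close>)
        finally have DYZ: "D * (Y * Z) = \<mu> \<cdot>\<^sub>m (Y * Z) - C * Z" .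
        have "X * D ^\<^sub>m Suc j * (Y * Z) = X * D ^\<^sub>m j * (D * (Y * Z))"
          using X D Y Z by (simp add: mult_assoc_dim)
        also have "\<dots> = X * D ^\<^sub>m j * (\<mu> \<cdot>\<^sub>m (Y * Z)) - X * D ^\<^sub>m j * (C * Z)"
          unfolding DYZ by (rule mult_minus_distrib_mat[OF XD _ CZ]) (use YZ in simp)
        also have "X * D ^\<^sub>m j * (\<mu> \<cdot>\<^sub>m (Y * Z)) = \<mu> \<cdot>\<^sub>m (X * D ^\<^sub>m j * (Y * Z))"
          by (rule mult_smult_distrib[OF XD YZ])
        finally have eq: "X * D ^\<^sub>m Suc j * (Y * Z)
            = \<mu> \<cdot>\<^sub>m (X * D ^\<^sub>m j * (Y * Z)) - X * D ^\<^sub>m j * (C * Z)" .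
        have "X * D ^\<^sub>m j * (Y * Z) \<in> carrier_mat s s" "X * D ^\<^sub>m j * (C * Z) \<in> carrier_mat s s"
          using XD YZ CZ by (meson mult_carrier_mat)+
        then show ?thesis unfolding eq using ab by (rule index_smult_minus_mat)
      qed
      have step: "\<psi> Y (Suc j) = \<mu> * \<psi> Y j - F (Suc j)" for j
      proof -
        have "Y * 1\<^sub>m s = Y" "C * 1\<^sub>m s = C" using Y C by simp_all
        then show ?thesis
          using lin[OF B T, of j] lin[OF TB one_carrier_mat, of j]
          by (simp add: \<psi>_def F_def right_diff_distrib del: pow_mat.simps)
      qed
      have start: "\<psi> Y 0 = - F 0"
      proof -
        define Z where "Z = B * Y"
        have Z: "Z \<in> carrier_mat s s" using B Y by (simp add: Z_def)
        have "B * R \<mu> * C = Z" unfolding Z_def Y_def by (rule assoc_mult_mat[OF B R C])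
        then have "(A + Z) * T = T * (A + Z)" using com[OF \<mu>] by simp
        then have "A * T + Z * T = T * A + T * Z"
          unfolding add_mult_distrib_mat[OF A Z T] mult_add_distrib_mat[OF T A Z] .
        from arg_cong[OF this, of "\<lambda>M. M $$ (a, b)"]
        have eq: "(A * T) $$ (a, b) + (Z * T) $$ (a, b) = (T * A) $$ (a, b) + (T * Z) $$ (a, b)"
          using A Z T ab by (simp del: index_mult_mat(1))
        have BZ: "B * D ^\<^sub>m 0 * (Y * T) = Z * T" "T * B * D ^\<^sub>m 0 * Y = T * Z"
          unfolding Z_def using B D Y T by (simp_all add: mult_assoc_dim)
        have "q - t = - (p - r)" if "p + q = r + t" for p q r t :: complex
        proof -
          have "q = r + t - p" unfolding that[symmetric] by simp
          then show ?thesis by simp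
        qed
        from this[OF eq] show ?thesis unfolding \<psi>_def F_def BZ nat.case .
      qed
      have "\<psi> Y j = - (\<Sum>i\<le>j. F (j - i) * \<mu> ^ i)" for j
      proof (induction j)
        case (Suc j)
        show ?case unfolding step Suc.IH sum.atMost_Suc_shift
          by (simp add: sum_distrib_left mult_ac)
      qed (use start in simp)
      then have "(\<Sum>i\<le>j. F (j - i) * \<mu> ^ i) = - \<psi> Y j" for j by simp
      then show ?thesis using \<psi>rec[OF Y, of 0] by (simp add: sum_negf)
    qed
    have F0: "F k = 0" if "k \<le> m" for k
      by (rule vanishing_polynomial_identity[OF cm U van that])
    have "\<psi> C k = 0"
    proof (rule linear_recurrence_eq_0[of c m, OF cm \<psi>rec[OF C]])
      show "\<psi> C k = 0" if "k < m" for k using F0[of "Suc k"] that by (simp add: F_def)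
    qed
    then show ?thesis using F0[of 0] by (simp add: F_def \<psi>_def)
  qed
  show "A * T = T * A"
    by (rule eq_matI) (use zero A T in \<open>auto simp del: index_mult_mat(1)\<close>)
  have BDk: "B * D ^\<^sub>m k \<in> carrier_mat s n" using B D by (meson mult_carrier_mat pow_carrier_mat)
  have "B * D ^\<^sub>m k * (C * T) = T * B * D ^\<^sub>m k * C"
    by (rule eq_matI) (use zero B C T D in \<open>auto simp del: index_mult_mat(1)\<close>)
  then show "B * D ^\<^sub>m k * C * T = T * (B * D ^\<^sub>m k * C)"
    using B C T D by (simp add: mult_assoc_dim)
qed

text \<open>
  Here \<open>M k\<close> and \<open>N k\<close> stand for the two blocks of \<open>H\<^sup>k\<close> with rows in \<open>S\<close>. By induction on \<open>j\<close>, the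
  matrix \<open>T\<close> commutes with \<open>N k D\<^sup>j C\<close> for all \<open>k\<close> simultaneously: the recursion for \<open>N\<close> gives
  \<open>N k D\<^sup>j\<^sup>+\<^sup>1 C = N (k + 1) D\<^sup>j C - M k (B D\<^sup>j C)\<close>, and \<open>B = N 1\<close>. The case \<open>k = 1\<close> is the claim.
\<close>

lemma power_blocks_moments_commute:
  fixes A B C D T :: "complex mat"
  assumes A: "A \<in> carrier_mat s s" and B: "B \<in> carrier_mat s n" and C: "C \<in> carrier_mat n s"
    and D: "D \<in> carrier_mat n n" and T: "T \<in> carrier_mat s s"
    and M: "M 0 = 1\<^sub>m s" "\<And>k. M (Suc k) = M k * A + N k * C" "\<And>k. M k * T = T * M k"
    and N: "N 0 = 0\<^sub>m s n" "\<And>k. N (Suc k) = M k * B + N k * D"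
  shows "A * T = T * A" "B * D ^\<^sub>m k * C * T = T * (B * D ^\<^sub>m k * C)"
proof -
  have car: "M k \<in> carrier_mat s s \<and> N k \<in> carrier_mat s n" for k
    by (induction k) (use A B C D M(1,2) N in auto)
  then have Mc: "M k \<in> carrier_mat s s" and Nc: "N k \<in> carrier_mat s n" for k by auto
  have M1: "M (Suc 0) = A" unfolding M(1,2) N(1) using A C by simp
  have N1: "N (Suc 0) = B" unfolding M(1) N using B D by simp
  define cm where "cm X \<longleftrightarrow> X \<in> carrier_mat s s \<and> X * T = T * X" for X
  have cm_mult: "cm (X * Y)" if "cm X" "cm Y" for X Y
  proof -
    have X: "X \<in> carrier_mat s s" "X * T = T * X" and Y: "Y \<in> carrier_mat s s" "Y * T = T * Y"
      using that by (auto simp: cm_def)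
    have "X * Y * T = X * (Y * T)" by (rule assoc_mult_mat[OF X(1) Y(1) T])
    also have "\<dots> = X * T * Y" unfolding Y(2) by (rule assoc_mult_mat[symmetric, OF X(1) T Y(1)])
    also have "\<dots> = T * (X * Y)" unfolding X(2) by (rule assoc_mult_mat[OF T X(1) Y(1)])
    finally show ?thesis using X Y by (simp add: cm_def)
  qed
  have cm_diff: "cm Y" if "cm (X + Y)" "cm X" "Y \<in> carrier_mat s s" for X Y
  proof -
    have X: "X \<in> carrier_mat s s" using that by (simp add: cm_def)
    have "X * T + Y * T = T * X + T * Y"
      using that(1) unfolding cm_def add_mult_distrib_mat[OF X that(3) T] mult_add_distrib_mat[OF T X that(3)] by simp
    then have eq: "T * X + Y * T = T * X + T * Y" using that(2) by (simp add: cm_def)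
    have "Y * T = T * Y"
    proof (rule eq_matI)
      fix i j assume "i < dim_row (T * Y)" "j < dim_col (T * Y)"
      then show "(Y * T) $$ (i, j) = (T * Y) $$ (i, j)"
        using arg_cong[OF eq, of "\<lambda>M. M $$ (i, j)"] X that(3) T by (simp del: index_mult_mat(1))
    qed (use that(3) T in auto)
    then show ?thesis using that(3) by (simp add: cm_def)
  qed
  have cmM: "cm (M k)" for k using Mc M(3) by (simp add: cm_def)
  have cmA: "cm A" using cmM[of "Suc 0"] M1 by simp
  have cmN: "cm (N k * (D ^\<^sub>m j * C))" for k j
  proof (induction j arbitrary: k)
    case 0
    have "cm (N k * C)"
    proof (rule cm_diff)
      show "cm (M k * A + N k * C)" using cmM[of "Suc k"] unfolding M(2) .
      show "cm (M k * A)" by (rule cm_mult[OF cmM cmA])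
    qed (rule mult_carrier_mat[OF Nc C])
    then show ?case using C D by simp
  next
    case (Suc j)
    have DC: "D ^\<^sub>m j * C \<in> carrier_mat n s" using D C by (meson mult_carrier_mat pow_carrier_mat)
    have "N (Suc k) * (D ^\<^sub>m j * C) = M k * B * (D ^\<^sub>m j * C) + N k * D * (D ^\<^sub>m j * C)"
      unfolding N(2) by (rule add_mult_distrib_mat[OF mult_carrier_mat[OF Mc B] mult_carrier_mat[OF Nc D] DC])
    also have "M k * B * (D ^\<^sub>m j * C) = M k * (N (Suc 0) * (D ^\<^sub>m j * C))"
      unfolding N1 by (rule assoc_mult_mat[OF Mc B DC])
    also have "N k * D * (D ^\<^sub>m j * C) = N k * (D ^\<^sub>m Suc j * C)"
      unfolding pow_mat_Suc_left[OF D] assoc_mult_mat[OF D pow_carrier_mat[OF D] C]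
      by (rule assoc_mult_mat[OF Nc D DC])
    finally have "cm (M k * (N (Suc 0) * (D ^\<^sub>m j * C)) + N k * (D ^\<^sub>m Suc j * C))"
      using Suc[of "Suc k"] by (simp del: pow_mat.simps)
    then show ?case
      by (rule cm_diff[OF _ cm_mult[OF cmM Suc]])
        (rule mult_carrier_mat[OF Nc mult_carrier_mat[OF pow_carrier_mat[OF D] C]])
  qed
  show "A * T = T * A" using cmA by (simp add: cm_def)
  have "B * D ^\<^sub>m k * C = B * (D ^\<^sub>m k * C)" by (rule assoc_mult_mat[OF B pow_carrier_mat[OF D] C])
  then show "B * D ^\<^sub>m k * C * T = T * (B * D ^\<^sub>m k * C)"
    using cmN[of "Suc 0" k] unfolding N1 cm_def by simp
qed

section \<open>Extending a commuting matrix to the complement\<close>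

text \<open>
  The closed form \<open>Q = L T P\<close> represents the map \<open>D\<^sup>k C v \<mapsto> D\<^sup>k C T v\<close>, extended by \<open>0\<close>. All
  computations rest on \<open>B D\<^sup>j (L X) = X B D\<^sup>j G\<close> for \<open>X\<close> that commutes with the moments: in every summand
  a moment meets \<open>X\<close> and passes through it. The matrix \<open>E = 1 - G P\<close> is a projection with \<open>G E = E G = 0\<close>,
  so it kills the Krylov space. Equality of two matrices can therefore be tested separately on
  the Krylov space, that is, after multiplication with \<open>G\<close> from the right, and likewise with \<open>E\<close>.
\<close>

lemma commuting_extension_exists:
  fixes B C D T :: "complex mat"
  assumes D: "D \<in> carrier_mat n n" "mat_adjoint D = D"
    and B: "B \<in> carrier_mat s n" and C: "C = mat_adjoint B"
    and T: "T \<in> carrier_mat s s" "normal_mat T"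
    and com: "\<And>k. B * D ^\<^sub>m k * C * T = T * (B * D ^\<^sub>m k * C)"
  shows "\<exists>Q \<in> carrier_mat n n. normal_mat Q \<and> Q * D = D * Q \<and> B * Q = T * B \<and> Q * C = C * T"
proof -
  have Cc: "C \<in> carrier_mat n s" using B C by simp
  have Dk [simp]: "D ^\<^sub>m k \<in> carrier_mat n n" "dim_row (D ^\<^sub>m k) = n" "dim_col (D ^\<^sub>m k) = n" for k
    using D by auto
  have dims [simp]: "dim_row D = n" "dim_col D = n" "dim_row B = s" "dim_col B = n"
    "dim_row C = n" "dim_col C = s" "dim_row T = s" "dim_col T = s"
    using D B Cc T by auto
  have adj [simp]: "mat_adjoint B = C" "mat_adjoint C = B" "mat_adjoint (D ^\<^sub>m k) = D ^\<^sub>m k" for k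
    using C D by (auto simp: mat_adjoint_pow)
  obtain m where m: "\<forall>p q. \<forall>X\<in>carrier_mat p n. \<forall>Y\<in>carrier_mat n q.
      (\<forall>j<m. X * D ^\<^sub>m j * Y = 0\<^sub>m p q) \<longrightarrow> (\<forall>k. X * D ^\<^sub>m k * Y = 0\<^sub>m p q)"
    using krylov_zero_from_initial_powers[OF D(1)] ..
  have closure: "X * D ^\<^sub>m k * Y = 0\<^sub>m p q"
    if "X \<in> carrier_mat p n" "Y \<in> carrier_mat n q" "\<And>j. j < m \<Longrightarrow> X * D ^\<^sub>m j * Y = 0\<^sub>m p q" for X Y p q k
    using m that by blast
  define W where "W k = B * D ^\<^sub>m k * C" for k
  have W [simp]: "dim_row (W k) = s" "dim_col (W k) = s" for k by (simp_all add: W_def)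
  define commuting where "commuting X \<longleftrightarrow> X \<in> carrier_mat s s \<and> (\<forall>k. W k * X = X * W k)" for X
  have c1: "commuting (1\<^sub>m s)" by (auto simp: commuting_def W_def)
  have cT: "commuting T" using com T by (simp add: commuting_def W_def)
  have cadj: "commuting (mat_adjoint X)" if "commuting X" for X
  proof -
    have X: "X \<in> carrier_mat s s" using that by (simp add: commuting_def)
    have Wa: "mat_adjoint (W k) = W k" for k
      unfolding W_def by (simp add: mat_adjoint_mult mult_assoc_dim)
    have "W k * mat_adjoint X = mat_adjoint X * W k" for k
    proof -
      have "mat_adjoint (X * W k) = mat_adjoint (W k * X)"
        using that by (simp add: commuting_def)
      then show ?thesis using X by (simp add: mat_adjoint_mult Wa)
    qed
    then show ?thesis using X by (simp add: commuting_def)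
  qed
  define L where "L X = mat_sum n n (\<lambda>k. D ^\<^sub>m k * C * X * B * D ^\<^sub>m k) {..<m}" for X
  have L [simp]: "L X \<in> carrier_mat n n" "dim_row (L X) = n" "dim_col (L X) = n" for X
    by (simp_all add: L_def)
  define G where "G = L (1\<^sub>m s)"
  have G [simp]: "G \<in> carrier_mat n n" "dim_row G = n" "dim_col G = n" by (simp_all add: G_def)
  have Gsum: "G = mat_sum n n (\<lambda>k. D ^\<^sub>m k * C * B * D ^\<^sub>m k) {..<m}"
    unfolding G_def L_def using right_mult_one_mat[OF mult_carrier_mat[OF Dk(1) Cc]] by simp
  have Ladj: "mat_adjoint (L X) = L (mat_adjoint X)" if "X \<in> carrier_mat s s" for X
    unfolding L_def using that by (subst mat_adjoint_mat_sum)
      (auto intro!: mat_sum_cong carrier_matI simp: mat_adjoint_mult mult_assoc_dim)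
  have Gadj: "mat_adjoint G = G"
    unfolding G_def by (subst Ladj) auto
  have mulL: "Z * L X = mat_sum p n (\<lambda>k. Z * D ^\<^sub>m k * C * X * B * D ^\<^sub>m k) {..<m}"
    if "Z \<in> carrier_mat p n" "X \<in> carrier_mat s s" for Z X p
    unfolding L_def using that by (subst mult_mat_sum[where nr=n])
      (auto intro!: mat_sum_cong carrier_matI simp: mult_assoc_dim)
  have Lmul: "L X * Z = mat_sum n p (\<lambda>k. D ^\<^sub>m k * C * X * (B * D ^\<^sub>m k * Z)) {..<m}"
    if "Z \<in> carrier_mat n p" "X \<in> carrier_mat s s" for Z X p
    unfolding L_def using that by (subst mat_sum_mult[where nc=n])
      (auto intro!: mat_sum_cong carrier_matI simp: mult_assoc_dim)
  \<comment> \<open>The moment \<open>B D\<^sup>j\<^sup>+\<^sup>k C\<close> arises next to \<open>X\<close> in each summand and is moved past it.\<close>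
  have BDL: "B * D ^\<^sub>m j * L X = X * (B * D ^\<^sub>m j * G)" if X: "commuting X" for X j
  proof -
    have Xc [simp]: "X \<in> carrier_mat s s" "dim_row X = s" "dim_col X = s"
      using X by (auto simp: commuting_def)
    have BD: "B * D ^\<^sub>m j \<in> carrier_mat s n" using B by simp
    have step: "B * D ^\<^sub>m j * D ^\<^sub>m k * C * X * B * D ^\<^sub>m k = X * (B * D ^\<^sub>m j * D ^\<^sub>m k * C * B * D ^\<^sub>m k)" for k
    proof -
      have W': "B * D ^\<^sub>m j * D ^\<^sub>m k * C = W (j + k)"
        unfolding W_def by (simp add: pow_mat_add[OF D(1)] mult_assoc_dim)
      have WX: "W (j + k) * X = X * W (j + k)" using X by (simp add: commuting_def)
      show ?thesis unfolding W' WX by (simp add: mult_assoc_dim)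
    qed
    have "B * D ^\<^sub>m j * L X = mat_sum s n (\<lambda>k. X * (B * D ^\<^sub>m j * D ^\<^sub>m k * C * B * D ^\<^sub>m k)) {..<m}"
      unfolding mulL[OF BD Xc(1)] step ..
    also have "\<dots> = X * mat_sum s n (\<lambda>k. B * D ^\<^sub>m j * D ^\<^sub>m k * C * B * D ^\<^sub>m k) {..<m}"
      by (rule mult_mat_sum[symmetric]) (auto intro!: carrier_matI)
    also have "mat_sum s n (\<lambda>k. B * D ^\<^sub>m j * D ^\<^sub>m k * C * B * D ^\<^sub>m k) {..<m} = B * D ^\<^sub>m j * G"
      unfolding Gsum by (subst mult_mat_sum[where nr=n])
        (auto intro!: mat_sum_cong carrier_matI simp: mult_assoc_dim)
    finally show ?thesis .
  qed
  \<comment> \<open>This is the adjoint of the previous identity for \<open>X\<^sup>*\<close>.\<close>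
  have LDC: "L X * (D ^\<^sub>m j * C) = G * (D ^\<^sub>m j * C) * X" if X: "commuting X" for X j
  proof -
    have Xc [simp]: "X \<in> carrier_mat s s" "dim_row X = s" "dim_col X = s"
      using X by (auto simp: commuting_def)
    have "mat_adjoint (B * D ^\<^sub>m j * L (mat_adjoint X)) = mat_adjoint (mat_adjoint X * (B * D ^\<^sub>m j * G))"
      unfolding BDL[OF cadj[OF X]] ..
    then show ?thesis by (simp add: mat_adjoint_mult Ladj Gadj mult_assoc_dim)
  qed
  have LL: "L X * L Y = L (X * Y) * G" if X: "commuting X" and Y: "commuting Y" for X Y
  proof -
    have c [simp]: "X \<in> carrier_mat s s" "Y \<in> carrier_mat s s" "dim_row X = s" "dim_col X = s"
      "dim_row Y = s" "dim_col Y = s"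
      using X Y by (auto simp: commuting_def)
    show ?thesis
      unfolding Lmul[OF L(1) c(1)] Lmul[OF G(1) mult_carrier_mat[OF c(1,2)]] BDL[OF Y]
      by (intro mat_sum_cong) (simp add: mult_assoc_dim)
  qed
  have GL: "G * L X = L X * G" if X: "commuting X" for X
  proof -
    have "X \<in> carrier_mat s s" using X by (simp add: commuting_def)
    then show ?thesis using LL[OF c1 X] unfolding G_def by (simp only: left_mult_one_mat)
  qed
  \<comment> \<open>\<open>Y\<^sup>* G Y\<close> is the sum of the Gram matrices of the first \<open>m\<close> matrices \<open>B D\<^sup>k Y\<close>.\<close>
  have ker: "B * D ^\<^sub>m k * Y = 0\<^sub>m s p" if Y: "Y \<in> carrier_mat n p" and GY: "G * Y = 0\<^sub>m n p" for Y p k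
  proof (rule closure[OF B Y])
    have Yd [simp]: "dim_row Y = n" "dim_col Y = p" using Y by auto
    have "mat_sum p p (\<lambda>k. mat_adjoint (B * D ^\<^sub>m k * Y) * (B * D ^\<^sub>m k * Y)) {..<m} = mat_adjoint Y * (G * Y)"
    proof -
      have "G * Y = mat_sum n p (\<lambda>k. D ^\<^sub>m k * C * B * D ^\<^sub>m k * Y) {..<m}"
        unfolding Gsum by (rule mat_sum_mult[OF Y]) (auto intro!: carrier_matI)
      then show ?thesis
        by (simp, subst mult_mat_sum[where nr=n])
          (auto intro!: mat_sum_cong carrier_matI simp: mat_adjoint_mult mult_assoc_dim)
    qed
    also have "\<dots> = 0\<^sub>m p p" unfolding GY by (rule right_mult_zero_mat) (use Y in simp)
    finally have z: "mat_sum p p (\<lambda>k. mat_adjoint (B * D ^\<^sub>m k * Y) * (B * D ^\<^sub>m k * Y)) {..<m} = 0\<^sub>m p p" .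
    show "B * D ^\<^sub>m j * Y = 0\<^sub>m s p" if "j < m" for j
      by (rule sum_adjoint_mult_self_eq_0[OF _ _ z]) (use that in \<open>auto intro!: carrier_matI\<close>)
  qed
  obtain P where P: "P \<in> carrier_mat n n" and GPG: "G * P * G = G"
    and Pcom: "\<And>Z. Z \<in> carrier_mat n n \<Longrightarrow> Z * G = G * Z \<Longrightarrow> Z * P = P * Z"
    using hermitian_generalized_inverse[OF G(1) Gadj] by blast
  have Pd [simp]: "dim_row P = n" "dim_col P = n" using P by auto
  have GP: "G * P = P * G" by (rule Pcom) simp_all
  \<comment> \<open>\<open>P\<close> need not be Hermitian, so \<open>B D\<^sup>k E = 0\<close> and \<open>E D\<^sup>k C = 0\<close> are not adjoint to each other:
  the former uses \<open>G E = 0\<close> and the latter uses \<open>E G = 0\<close>.\<close>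
  define E where "E = 1\<^sub>m n - G * P"
  have E [simp]: "E \<in> carrier_mat n n" "dim_row E = n" "dim_col E = n"
    unfolding E_def by (auto intro!: carrier_matI)
  have GE: "G * E = 0\<^sub>m n n"
  proof -
    have "G * E = G - G * (G * P)" unfolding E_def
      by (subst mult_minus_distrib_mat[where n=n and nc=n]) (auto intro!: carrier_matI)
    also have "G * (G * P) = G * (P * G)"
      by (rule arg_cong[OF GP])
    also have "\<dots> = G * P * G"
      by (rule mult_assoc_dim[symmetric]) simp_all
    finally show ?thesis unfolding GPG by simp
  qed
  have EG: "E * G = 0\<^sub>m n n"
  proof -
    have "E * G = G - G * P * G" unfolding E_def
      by (subst minus_mult_distrib_mat[where n=n and nr=n and nc=n]) (auto intro!: carrier_matI)
    then show ?thesis unfolding GPG by simp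
  qed
  have BDE: "B * D ^\<^sub>m k * E = 0\<^sub>m s n" for k by (rule ker[OF E(1) GE])
  have EDC: "E * (D ^\<^sub>m k * C) = 0\<^sub>m n s" for k
  proof -
    have "mat_adjoint (E * G) = 0\<^sub>m n n" unfolding EG by simp
    then have "G * mat_adjoint E = 0\<^sub>m n n" by (simp add: mat_adjoint_mult Gadj)
    from ker[OF mat_adjoint_carrier[OF E(1)] this, of k]
    have "mat_adjoint (B * D ^\<^sub>m k * mat_adjoint E) = 0\<^sub>m n s" by simp
    then show ?thesis by (simp add: mat_adjoint_mult)
  qed
  have splitE: "Z * (G * P) = Z - Z * E" if "Z \<in> carrier_mat p n" for Z p
  proof -
    have "Z * E = Z - Z * (G * P)" unfolding E_def using that
      by (subst mult_minus_distrib_mat[where n=n and nc=n]) (auto intro!: carrier_matI)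
    moreover have "Z * (G * P) \<in> carrier_mat p n" using that by (auto intro!: carrier_matI)
    ultimately show ?thesis using minus_minus_mat[OF that] by simp
  qed
  have splitE': "G * P * Z = Z - E * Z" if "Z \<in> carrier_mat n p" for Z p
  proof -
    have "E * Z = Z - G * P * Z" unfolding E_def using that
      by (subst minus_mult_distrib_mat[where n=n and nc=p and nr=n]) (auto intro!: carrier_matI)
    moreover have "G * P * Z \<in> carrier_mat n p" using that by (auto intro!: carrier_matI)
    ultimately show ?thesis using minus_minus_mat[OF that] by simp
  qed
  define Q where "Q = L T * P"
  have Q [simp]: "Q \<in> carrier_mat n n" "dim_row Q = n" "dim_col Q = n"
    unfolding Q_def by (auto intro!: carrier_matI)
  have LP: "L X * P = P * L X" if "commuting X" for X
    by (rule Pcom) (simp_all add: GL[OF that])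
  have BQ: "B * D ^\<^sub>m k * Q = T * (B * D ^\<^sub>m k)" for k
  proof -
    have BD: "B * D ^\<^sub>m k \<in> carrier_mat s n" using B by simp
    have "B * D ^\<^sub>m k * Q = B * D ^\<^sub>m k * L T * P" unfolding Q_def by (simp add: mult_assoc_dim)
    also have "\<dots> = T * (B * D ^\<^sub>m k * (G * P))" unfolding BDL[OF cT] by (simp add: mult_assoc_dim)
    also have "B * D ^\<^sub>m k * (G * P) = B * D ^\<^sub>m k" unfolding splitE[OF BD] BDE by (rule minus_mat_zero[OF BD])
    finally show ?thesis .
  qed
  have QC: "Q * (D ^\<^sub>m k * C) = D ^\<^sub>m k * C * T" for k
  proof -
    have DC: "D ^\<^sub>m k * C \<in> carrier_mat n s" using Cc by (auto intro!: carrier_matI)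
    have "Q * (D ^\<^sub>m k * C) = P * (L T * (D ^\<^sub>m k * C))" unfolding Q_def LP[OF cT] by (simp add: mult_assoc_dim)
    also have "\<dots> = G * P * (D ^\<^sub>m k * C) * T" unfolding LDC[OF cT] GP by (simp add: mult_assoc_dim)
    also have "G * P * (D ^\<^sub>m k * C) = D ^\<^sub>m k * C" unfolding splitE'[OF DC] EDC by (rule minus_mat_zero[OF DC])
    finally show ?thesis .
  qed
  have QD: "Q * D = D * Q"
  proof -
    have LTz: "L T * Z = 0\<^sub>m n n" if "Z \<in> carrier_mat n n" "\<And>k. B * D ^\<^sub>m k * Z = 0\<^sub>m s n" for Z
      unfolding Lmul[OF that(1) T(1)] that(2) by (intro mat_sum_zero) (auto intro!: right_mult_zero_mat carrier_matI)
    have QE: "Q * E = 0\<^sub>m n n"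
      unfolding Q_def LP[OF cT] using LTz[OF E(1) BDE] P by (simp add: mult_assoc_dim)
    have "B * D ^\<^sub>m k * (D * E) = 0\<^sub>m s n" for k
      using BDE[of "Suc k"] by (simp add: mult_assoc_dim)
    then have "L T * (D * E) = 0\<^sub>m n n" by (intro LTz) (auto intro!: carrier_matI)
    then have QDE: "Q * (D * E) = 0\<^sub>m n n"
      unfolding Q_def LP[OF cT] using P by (simp add: mult_assoc_dim)
    \<comment> \<open>\<open>Y G = 0\<close> since both terms send \<open>D\<^sup>k C\<close> to \<open>D\<^sup>k\<^sup>+\<^sup>1 C T\<close>, and \<open>Y E = 0\<close> since \<open>D\<close> preserves the
    orthogonal complement of the Krylov space.\<close>
    define Y where "Y = Q * D - D * Q"
    have Y [simp]: "Y \<in> carrier_mat n n" "dim_row Y = n" "dim_col Y = n"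
      unfolding Y_def by (auto intro!: carrier_matI)
    have YZ: "Y * Z = Q * (D * Z) - D * (Q * Z)" if "Z \<in> carrier_mat n p" for Z p
      unfolding Y_def using that by (subst minus_mult_distrib_mat[where n=n and nc=p and nr=n])
        (auto intro!: carrier_matI simp: mult_assoc_dim)
    have YDC: "Y * (D ^\<^sub>m k * C) = 0\<^sub>m n s" for k
    proof -
      have DC: "D ^\<^sub>m k * C \<in> carrier_mat n s" using Cc by (auto intro!: carrier_matI)
      have "D * (D ^\<^sub>m k * C) = D ^\<^sub>m Suc k * C"
        unfolding pow_mat_Suc_left[OF D(1)] by (simp add: mult_assoc_dim)
      then have "Y * (D ^\<^sub>m k * C) = D ^\<^sub>m Suc k * C * T - D * (D ^\<^sub>m k * C * T)"
        unfolding YZ[OF DC] by (simp only: QC)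
      also have "D * (D ^\<^sub>m k * C * T) = D ^\<^sub>m Suc k * C * T"
        unfolding pow_mat_Suc_left[OF D(1)] by (simp add: mult_assoc_dim)
      finally show ?thesis
        by (simp add: minus_r_inv_mat[of _ n s] carrier_matI del: pow_mat.simps)
    qed
    have "Y * G = mat_sum n n (\<lambda>k. Y * (D ^\<^sub>m k * C) * (B * D ^\<^sub>m k)) {..<m}"
      unfolding Gsum by (subst mult_mat_sum[where nr=n])
        (auto intro!: mat_sum_cong carrier_matI simp: mult_assoc_dim)
    also have "\<dots> = 0\<^sub>m n n"
      unfolding YDC by (intro mat_sum_zero) (auto intro!: left_mult_zero_mat carrier_matI)
    finally have YG: "Y * G = 0\<^sub>m n n" .
    have "Y * E = 0\<^sub>m n n" unfolding YZ[OF E(1)] QDE QE using D(1) by simp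
    moreover have "Y * (G * P) = Y * G * P" by (simp add: mult_assoc_dim)
    then have "Y * (G * P) = 0\<^sub>m n n" unfolding YG using P by simp
    ultimately have "Y = 0\<^sub>m n n" using splitE[OF Y(1)] minus_mat_zero[OF Y(1)] by simp
    then have "Q * D - D * Q = 0\<^sub>m n n" unfolding Y_def .
    then show ?thesis by (rule minus_mat_eq_0D) (auto intro!: carrier_matI)
  qed
  \<comment> \<open>The factors \<open>L T\<close>, \<open>L T\<^sup>*\<close>, \<open>P\<close> and \<open>P\<^sup>*\<close> all commute with each other.\<close>
  have "normal_mat Q"
  proof -
    define P' where "P' = mat_adjoint P"
    have P' [simp]: "dim_row P' = n" "dim_col P' = n" by (simp_all add: P'_def)
    define T' where "T' = mat_adjoint T"
    have T' [simp]: "dim_row T' = s" "dim_col T' = s" by (simp_all add: T'_def)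
    have cT': "commuting T'" unfolding T'_def by (rule cadj[OF cT])
    have P'L: "P' * L X = L X * P'" if X: "commuting X" for X
    proof -
      have Xc [simp]: "X \<in> carrier_mat s s" using X by (auto simp: commuting_def)
      have "mat_adjoint (L (mat_adjoint X) * P) = mat_adjoint (P * L (mat_adjoint X))"
        unfolding LP[OF cadj[OF X]] ..
      then show ?thesis unfolding P'_def by (simp add: mat_adjoint_mult Ladj)
    qed
    have P'P: "P' * P = P * P'"
    proof (rule Pcom)
      have "mat_adjoint (G * P) = mat_adjoint (P * G)" unfolding GP ..
      then show "P' * G = G * P'" unfolding P'_def by (simp add: mat_adjoint_mult Gadj)
    qed (use P in \<open>simp add: P'_def\<close>)
    have TT: "T * T' = T' * T" using T(2) unfolding normal_mat_def T'_def .
    have LLc: "L T * L T' = L T' * L T" unfolding LL[OF cT cT'] LL[OF cT' cT] TT ..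
    have Qa: "mat_adjoint Q = P' * L T'"
      unfolding Q_def P'_def T'_def by (simp add: mat_adjoint_mult Ladj T(1))
    have "Q * mat_adjoint Q = Q * (P' * L T')" unfolding Qa ..
    also have "\<dots> = L T * (P * P') * L T'" unfolding Q_def by (simp add: mult_assoc_dim)
    also have "\<dots> = L T * P' * (P * L T')" unfolding P'P[symmetric] by (simp add: mult_assoc_dim)
    also have "\<dots> = P' * (L T * L T') * P"
      unfolding LP[OF cT', symmetric] P'L[OF cT, symmetric] by (simp add: mult_assoc_dim)
    also have "\<dots> = P' * L T' * Q" unfolding LLc Q_def by (simp add: mult_assoc_dim)
    also have "\<dots> = mat_adjoint Q * Q" unfolding Qa ..
    finally show ?thesis unfolding normal_mat_def .
  qed
  moreover have "B * Q = T * B" using BQ[of 0] B Q D by simp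
  moreover have "Q * C = C * T" using QC[of 0] Cc D by simp
  ultimately show ?thesis using Q(1) QD by blast
qed

section \<open>Blocks of a matrix\<close>

lemma dim_submatrix_subset:
  assumes "M \<in> carrier_mat N N" "I \<subseteq> {..<N}"
  shows "dim_row (submatrix M I J) = card I" "dim_col (submatrix M J I) = card I"
proof -
  have "{i. i < N \<and> i \<in> I} = I" using assms(2) by auto
  then show "dim_row (submatrix M I J) = card I" "dim_col (submatrix M J I) = card I"
    using assms(1) by (simp_all add: dim_submatrix)
qed

lemma submatrix_carrier:
  assumes "M \<in> carrier_mat N N" "I \<subseteq> {..<N}" "J \<subseteq> {..<N}"
  shows "submatrix M I J \<in> carrier_mat (card I) (card J)"
  using dim_submatrix_subset[OF assms(1)] assms(2,3) by (auto intro: carrier_matI)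

lemma index_submatrix_subset:
  assumes "M \<in> carrier_mat N N" "I \<subseteq> {..<N}" "J \<subseteq> {..<N}" "i < card I" "j < card J"
  shows "submatrix M I J $$ (i, j) = M $$ (pick I i, pick J j)"
proof -
  have "{i. i < N \<and> i \<in> I} = I" "{i. i < N \<and> i \<in> J} = J" using assms(2,3) by auto
  then show ?thesis
    using assms(1,4,5) by (intro submatrix_index) simp_all
qed

lemma bij_betw_pick:
  assumes "finite I"
  shows "bij_betw (pick I) {..<card I} I"
  unfolding bij_betw_def
proof
  show "inj_on (pick I) {..<card I}"
    by (rule inj_on_inverseI[where g="\<lambda>x. card {a \<in> I. a < x}"]) (simp add: card_pick_le)
  show "pick I ` {..<card I} = I"
  proof
    show "pick I ` {..<card I} \<subseteq> I" using pick_in_set_le by auto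
    show "I \<subseteq> pick I ` {..<card I}"
    proof
      fix i assume i: "i \<in> I"
      have "{a \<in> I. a < i} \<subset> I" using i by blast
      then have "card {a \<in> I. a < i} \<in> {..<card I}"
        using assms by (simp add: psubset_card_mono)
      then show "i \<in> pick I ` {..<card I}"
        by (rule image_eqI[where f="pick I", rotated]) (rule pick_card_in_set[OF i, symmetric])
    qed
  qed
qed

text \<open>
  Split the inner summation index according to membership in \<open>S\<close>.
\<close>

lemma submatrix_mult:
  fixes X Y :: "complex mat"
  assumes X: "X \<in> carrier_mat N N" and Y: "Y \<in> carrier_mat N N"
    and I: "I \<subseteq> {..<N}" and J: "J \<subseteq> {..<N}" and S: "S \<subseteq> {..<N}"
  shows "submatrix (X * Y) I J
       = submatrix X I S * submatrix Y S J + submatrix X I ({..<N} - S) * submatrix Y ({..<N} - S) J"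
    (is "?l = ?r")
proof (rule eq_matI)
  let ?S' = "{..<N} - S"
  have XY: "X * Y \<in> carrier_mat N N" using X Y by simp
  have S': "?S' \<subseteq> {..<N}" by auto
  note dims = dim_submatrix_subset[OF X I] dim_submatrix_subset[OF X S] dim_submatrix_subset[OF X S']
    dim_submatrix_subset[OF Y J] dim_submatrix_subset[OF Y S] dim_submatrix_subset[OF Y S']
    dim_submatrix_subset[OF XY I] dim_submatrix_subset[OF XY J]
  show "dim_row ?l = dim_row ?r" "dim_col ?l = dim_col ?r" by (simp_all add: dims)
  fix i j assume "i < dim_row ?r" "j < dim_col ?r"
  then have i: "i < card I" and j: "j < card J" by (simp_all add: dims)
  have "pick I i < N" "pick J j < N" using i j I J pick_in_set_le by (auto simp: subset_iff)
  have part: "(submatrix X I K * submatrix Y K J) $$ (i, j) = (\<Sum>l\<in>K. X $$ (pick I i, l) * Y $$ (l, pick J j))"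
    if K: "K \<subseteq> {..<N}" for K
  proof -
    have "finite K" using K finite_subset by blast
    have "(submatrix X I K * submatrix Y K J) $$ (i, j)
        = (\<Sum>l<card K. X $$ (pick I i, pick K l) * Y $$ (pick K l, pick J j))"
      using i j by (simp add: dims dim_submatrix_subset[OF X K] dim_submatrix_subset[OF Y K]
        scalar_prod_def index_submatrix_subset[OF X I K] index_submatrix_subset[OF Y K J] atLeast0LessThan)
    also have "\<dots> = (\<Sum>l\<in>K. X $$ (pick I i, l) * Y $$ (l, pick J j))"
      by (rule sum.reindex_bij_betw[OF bij_betw_pick[OF \<open>finite K\<close>]])
    finally show ?thesis .
  qed
  have "?l $$ (i, j) = (\<Sum>l<N. X $$ (pick I i, l) * Y $$ (l, pick J j))"
    using X Y \<open>pick I i < N\<close> \<open>pick J j < N\<close>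
    by (simp add: index_submatrix_subset[OF XY I J i j] scalar_prod_def atLeast0LessThan)
  also have "\<dots> = (\<Sum>l\<in>S. X $$ (pick I i, l) * Y $$ (l, pick J j))
      + (\<Sum>l\<in>?S'. X $$ (pick I i, l) * Y $$ (l, pick J j))"
    unfolding sum.subset_diff[OF S finite_lessThan] by (rule add.commute)
  also have "\<dots> = ?r $$ (i, j)"
    unfolding part[OF S, symmetric] part[OF S', symmetric]
    by (rule index_add_mat(1)[symmetric]) (simp_all add: dims i j)
  finally show "?l $$ (i, j) = ?r $$ (i, j)" .
qed

lemma submatrix_adjoint:
  assumes "M \<in> carrier_mat N N" "I \<subseteq> {..<N}" "J \<subseteq> {..<N}"
  shows "submatrix (mat_adjoint M) I J = mat_adjoint (submatrix M J I)"
proof (rule eq_matI)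
  have M': "mat_adjoint M \<in> carrier_mat N N" using assms by simp
  note dims = dim_submatrix_subset[OF M' assms(2)] dim_submatrix_subset[OF M' assms(3)]
    dim_submatrix_subset[OF assms(1,2)] dim_submatrix_subset[OF assms(1,3)]
  show "dim_row (submatrix (mat_adjoint M) I J) = dim_row (mat_adjoint (submatrix M J I))"
    "dim_col (submatrix (mat_adjoint M) I J) = dim_col (mat_adjoint (submatrix M J I))"
    by (simp_all add: dims)
  fix i j assume "i < dim_row (mat_adjoint (submatrix M J I))" "j < dim_col (mat_adjoint (submatrix M J I))"
  then have ij: "i < card I" "j < card J" by (simp_all add: dims)
  have "pick I i < N" "pick J j < N" using ij assms(2,3) pick_in_set_le by (auto simp: subset_iff)
  then show "submatrix (mat_adjoint M) I J $$ (i, j) = mat_adjoint (submatrix M J I) $$ (i, j)"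
    using assms(1) ij by (simp add: dims index_submatrix_subset[OF M' assms(2,3)]
        index_submatrix_subset[OF assms(1,3,2)])
qed

lemma block_mat_eqI:
  assumes X: "X \<in> carrier_mat N N" and Y: "Y \<in> carrier_mat N N" and S: "S \<subseteq> {..<N}"
    and eq: "submatrix X S S = submatrix Y S S" "submatrix X S ({..<N} - S) = submatrix Y S ({..<N} - S)"
      "submatrix X ({..<N} - S) S = submatrix Y ({..<N} - S) S"
      "submatrix X ({..<N} - S) ({..<N} - S) = submatrix Y ({..<N} - S) ({..<N} - S)"
  shows "X = Y"
proof (rule eq_matI)
  fix i j assume "i < dim_row Y" "j < dim_col Y"
  then have ij: "i < N" "j < N" using Y by auto
  define I where "I = (if i \<in> S then S else {..<N} - S)"
  define J where "J = (if j \<in> S then S else {..<N} - S)"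
  have "i \<in> I" "j \<in> J" using ij by (auto simp: I_def J_def)
  moreover have "submatrix X I J = submatrix Y I J" using eq by (simp add: I_def J_def)
  ultimately show "X $$ (i, j) = Y $$ (i, j)"
    using submatrix_index_card[of i X j I J] submatrix_index_card[of i Y j I J] X Y ij by simp
qed (use X Y in auto)

text \<open>
  The rank of an index within its own set, \<open>r I i\<close>, inverts the enumeration \<open>pick I\<close>.
\<close>

lemma direct_sum_exists:
  fixes T T' :: "complex mat"
  assumes S: "S \<subseteq> {..<N}" and T: "T \<in> carrier_mat (card S) (card S)"
    and T': "T' \<in> carrier_mat (card ({..<N} - S)) (card ({..<N} - S))"
  obtains Q where "Q \<in> carrier_mat N N" "is_direct_sum S Q T T'"
proof -
  define S' where "S' = {..<N} - S"
  have S': "S' \<subseteq> {..<N}" by (auto simp: S'_def)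
  define r where "r I i = card {a \<in> I. a < i}" for I and i :: nat
  define Q where "Q = mat N N (\<lambda>(i, j). if i \<in> S \<and> j \<in> S then T $$ (r S i, r S j)
      else if i \<in> S' \<and> j \<in> S' then T' $$ (r S' i, r S' j) else 0)"
  have Q: "Q \<in> carrier_mat N N" by (simp add: Q_def)
  have Qi: "Q $$ (i, j) = (if i \<in> S \<and> j \<in> S then T $$ (r S i, r S j)
      else if i \<in> S' \<and> j \<in> S' then T' $$ (r S' i, r S' j) else 0)" if "i < N" "j < N" for i j
    using that by (simp add: Q_def)
  have rp: "r I (pick I i) = i" if "i < card I" for I i
    unfolding r_def by (rule card_pick_le[OF that])
  have pk: "pick S i \<in> S" "pick S i < N" "pick S i \<notin> S'" if "i < card S" for i
    using pick_in_set_le[of i S] that S by (auto simp: S'_def)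
  have pk': "pick S' i \<in> S'" "pick S' i < N" "pick S' i \<notin> S" if "i < card S'" for i
    using pick_in_set_le[of i S'] that by (auto simp: S'_def)
  note dims = dim_submatrix_subset[OF Q S] dim_submatrix_subset[OF Q S']
  have T'2: "T' \<in> carrier_mat (card S') (card S')" using T' by (simp add: S'_def)
  have "submatrix Q S S = T"
    by (rule eq_matI) (use T in \<open>auto simp: dims index_submatrix_subset[OF Q S S] Qi rp pk\<close>)
  moreover have "submatrix Q S' S' = T'"
    by (rule eq_matI) (use T'2 in \<open>auto simp: dims index_submatrix_subset[OF Q S' S'] Qi rp pk'\<close>)
  moreover have "submatrix Q S S' = 0\<^sub>m (card S) (card S')"
    by (rule eq_matI) (auto simp: dims index_submatrix_subset[OF Q S S'] Qi pk pk')
  moreover have "submatrix Q S' S = 0\<^sub>m (card S') (card S)"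
    by (rule eq_matI) (auto simp: dims index_submatrix_subset[OF Q S' S] Qi pk pk')
  moreover have "co_index Q S = S'" using Q by (simp add: co_index_def S'_def)
  ultimately have "is_direct_sum S Q T T'" by (simp add: is_direct_sum_def Let_def)
  with Q show thesis by (rule that)
qed

lemma submatrix_one:
  assumes S: "S \<subseteq> {..<N}"
  shows "submatrix (1\<^sub>m N) S S = 1\<^sub>m (card S)"
proof (rule eq_matI)
  have inj: "inj_on (pick S) {..<card S}"
    using bij_betw_pick[of S] S finite_subset by (auto simp: bij_betw_def)
  fix i j assume ij: "i < dim_row (1\<^sub>m (card S))" "j < dim_col (1\<^sub>m (card S))"
  then have "pick S i < N" "pick S j < N" using S pick_in_set_le by (auto simp: subset_iff)
  moreover have "pick S i = pick S j \<longleftrightarrow> i = j" using inj_on_eq_iff[OF inj] ij by simp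
  ultimately show "submatrix (1\<^sub>m N) S S $$ (i, j) = 1\<^sub>m (card S) $$ (i, j)"
    using ij by (simp add: index_submatrix_subset[OF one_carrier_mat S S])
qed (use dim_submatrix_subset[OF one_carrier_mat S] in simp_all)

lemma submatrix_one_off_diagonal:
  assumes S: "S \<subseteq> {..<N}" and S': "S' \<subseteq> {..<N}" and "S \<inter> S' = {}"
  shows "submatrix (1\<^sub>m N) S S' = 0\<^sub>m (card S) (card S')"
proof (rule eq_matI)
  fix i j assume ij: "i < dim_row (0\<^sub>m (card S) (card S'))" "j < dim_col (0\<^sub>m (card S) (card S'))"
  then have "pick S i \<in> S" "pick S' j \<in> S'" using pick_in_set_le by auto
  then have "pick S i < N" "pick S' j < N" "pick S i \<noteq> pick S' j" using assms by auto
  then show "submatrix (1\<^sub>m N) S S' $$ (i, j) = 0\<^sub>m (card S) (card S') $$ (i, j)"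
    using ij by (simp add: index_submatrix_subset[OF one_carrier_mat S S'])
qed (use dim_submatrix_subset[OF one_carrier_mat] S S' in simp_all)

section \<open>Direct sums and the reduction\<close>

text \<open>
  Multiplication by a direct sum acts block by block, so commuting with it amounts to four
  independent equations.
\<close>

lemma direct_sum_mult_blocks:
  fixes X Q :: "complex mat"
  assumes Q: "Q \<in> carrier_mat N N" and X: "X \<in> carrier_mat N N" and S: "S \<subseteq> {..<N}" and J: "J \<subseteq> {..<N}"
    and ds: "is_direct_sum S Q T Q'"
  shows "submatrix (Q * X) S J = T * submatrix X S J"
    "submatrix (Q * X) ({..<N} - S) J = Q' * submatrix X ({..<N} - S) J"
    "submatrix (X * Q) J S = submatrix X J S * T"
    "submatrix (X * Q) J ({..<N} - S) = submatrix X J ({..<N} - S) * Q'"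
proof -
  define S' where "S' = {..<N} - S"
  have S': "S' \<subseteq> {..<N}" by (auto simp: S'_def)
  have blocks: "submatrix Q S S = T" "submatrix Q S' S' = Q'"
    "submatrix Q S S' = 0\<^sub>m (card S) (card S')" "submatrix Q S' S = 0\<^sub>m (card S') (card S)"
    using ds Q by (simp_all add: is_direct_sum_def Let_def co_index_def S'_def)
  have car: "T \<in> carrier_mat (card S) (card S)" "Q' \<in> carrier_mat (card S') (card S')"
    using submatrix_carrier[OF Q S S] submatrix_carrier[OF Q S' S'] by (simp_all add: blocks)
  note X' = submatrix_carrier[OF X S J] submatrix_carrier[OF X S' J]
    submatrix_carrier[OF X J S] submatrix_carrier[OF X J S']
  note mult = submatrix_mult[OF Q X _ J S] submatrix_mult[OF X Q J _ S]
  show "submatrix (Q * X) S J = T * submatrix X S J"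
    "submatrix (Q * X) ({..<N} - S) J = Q' * submatrix X ({..<N} - S) J"
    "submatrix (X * Q) J S = submatrix X J S * T"
    "submatrix (X * Q) J ({..<N} - S) = submatrix X J ({..<N} - S) * Q'"
    unfolding S'_def[symmetric]
    using X' mult_carrier_mat[OF car(1) X'(1)] mult_carrier_mat[OF car(2) X'(2)]
      mult_carrier_mat[OF X'(3) car(1)] mult_carrier_mat[OF X'(4) car(2)]
    by (simp_all add: mult[OF S, folded S'_def] mult[OF S'[unfolded S'_def], folded S'_def] blocks)
qed

lemma normal_direct_sum:
  fixes Q T Q' :: "complex mat"
  assumes Q: "Q \<in> carrier_mat N N" and S: "S \<subseteq> {..<N}"
    and ds: "is_direct_sum S Q T Q'" and T: "normal_mat T" and Q': "normal_mat Q'"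
  shows "normal_mat Q"
proof -
  define S' where "S' = {..<N} - S"
  have S': "S' \<subseteq> {..<N}" by (auto simp: S'_def)
  have Qa: "mat_adjoint Q \<in> carrier_mat N N" using Q by simp
  have blocks: "submatrix Q S S = T" "submatrix Q S' S' = Q'"
    "submatrix Q S S' = 0\<^sub>m (card S) (card S')" "submatrix Q S' S = 0\<^sub>m (card S') (card S)"
    using ds Q by (simp_all add: is_direct_sum_def Let_def co_index_def S'_def)
  have car: "T \<in> carrier_mat (card S) (card S)" "Q' \<in> carrier_mat (card S') (card S')"
    using submatrix_carrier[OF Q S S] submatrix_carrier[OF Q S' S'] by (simp_all add: blocks)
  have ablocks: "submatrix (mat_adjoint Q) S S = mat_adjoint T"
    "submatrix (mat_adjoint Q) S' S' = mat_adjoint Q'"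
    "submatrix (mat_adjoint Q) S S' = 0\<^sub>m (card S) (card S')"
    "submatrix (mat_adjoint Q) S' S = 0\<^sub>m (card S') (card S)"
    using S S' by (simp_all add: submatrix_adjoint[OF Q] blocks)
  note mult = direct_sum_mult_blocks[OF Q Qa S _ ds, folded S'_def]
  have "Q * mat_adjoint Q = mat_adjoint Q * Q"
  proof (rule block_mat_eqI[OF _ _ S, folded S'_def])
    show "submatrix (Q * mat_adjoint Q) S S = submatrix (mat_adjoint Q * Q) S S"
      unfolding mult(1)[OF S] mult(3)[OF S] ablocks using T by (simp add: normal_mat_def)
    show "submatrix (Q * mat_adjoint Q) S' S' = submatrix (mat_adjoint Q * Q) S' S'"
      unfolding mult(2)[OF S'] mult(4)[OF S'] ablocks using Q' by (simp add: normal_mat_def)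
    show "submatrix (Q * mat_adjoint Q) S S' = submatrix (mat_adjoint Q * Q) S S'"
      unfolding mult(1)[OF S'] mult(4)[OF S] ablocks using car by simp
    show "submatrix (Q * mat_adjoint Q) S' S = submatrix (mat_adjoint Q * Q) S' S"
      unfolding mult(2)[OF S] mult(3)[OF S'] ablocks using car by simp
  qed (use Q in auto)
  then show ?thesis unfolding normal_mat_def .
qed

text \<open>
  A kernel vector of \<open>\<mu> - D\<close> would be an eigenvector, so the inverse exists away from the spectrum.
  The last equation is the only property of the resolvent that recovering the moments requires.
\<close>

lemma mat_inverse_resolvent:
  fixes D :: "complex mat"
  assumes D: "D \<in> carrier_mat n n" and \<mu>: "\<mu> \<notin> spectrum D"
  defines "R \<equiv> the (mat_inverse (\<mu> \<cdot>\<^sub>m 1\<^sub>m n - D))"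
  shows "R \<in> carrier_mat n n" "(\<mu> \<cdot>\<^sub>m 1\<^sub>m n - D) * R = 1\<^sub>m n" "R * (\<mu> \<cdot>\<^sub>m 1\<^sub>m n - D) = 1\<^sub>m n"
    "D * R = \<mu> \<cdot>\<^sub>m R - 1\<^sub>m n"
proof -
  let ?M = "\<mu> \<cdot>\<^sub>m 1\<^sub>m n - D"
  have M: "?M \<in> carrier_mat n n" using D by auto
  have mv: "?M *\<^sub>v v = \<mu> \<cdot>\<^sub>v v - D *\<^sub>v v" if v: "v \<in> carrier_vec n" for v
  proof -
    have "?M *\<^sub>v v = (\<mu> \<cdot>\<^sub>m 1\<^sub>m n) *\<^sub>v v - D *\<^sub>v v"
      by (rule minus_mult_distrib_mat_vec[OF _ D v]) simp
    also have "(\<mu> \<cdot>\<^sub>m 1\<^sub>m n) *\<^sub>v v = \<mu> \<cdot>\<^sub>v v"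
      using v by (intro eq_vecI) auto
    finally show ?thesis .
  qed
  have "det ?M \<noteq> 0"
  proof
    assume "det ?M = 0"
    then obtain v where v: "v \<in> carrier_vec n" "v \<noteq> 0\<^sub>v n" and z: "?M *\<^sub>v v = 0\<^sub>v n"
      using det_0_iff_vec_prod_zero[OF M] by auto
    have "D *\<^sub>v v = \<mu> \<cdot>\<^sub>v v"
    proof (rule eq_vecI)
      fix i assume i: "i < dim_vec (\<mu> \<cdot>\<^sub>v v)"
      have "(\<mu> \<cdot>\<^sub>v v - D *\<^sub>v v) $ i = 0" using z i v unfolding mv[OF v(1)] by simp
      then show "(D *\<^sub>v v) $ i = (\<mu> \<cdot>\<^sub>v v) $ i" using i v D by (simp del: index_mult_mat_vec)
    qed (use v D in auto)
    then have "eigenvalue D \<mu>" unfolding eigenvalue_def eigenvector_def using v D by auto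
    then show False using \<mu> by (simp add: spectrum_def)
  qed
  then have "?M \<in> Units (ring_mat TYPE(complex) n ())" by (rule det_non_zero_imp_unit[OF M])
  then obtain R' where R': "mat_inverse ?M = Some R'" using mat_inverse(1)[OF M, where b = "()"] by (cases "mat_inverse ?M") auto
  then have "R = R'" by (simp add: R_def)
  with mat_inverse(2)[OF M R'] have R: "R \<in> carrier_mat n n" "?M * R = 1\<^sub>m n" "R * ?M = 1\<^sub>m n" by auto
  then show "R \<in> carrier_mat n n" "?M * R = 1\<^sub>m n" "R * ?M = 1\<^sub>m n" by auto
  have "?M * R = \<mu> \<cdot>\<^sub>m 1\<^sub>m n * R - D * R"
    by (rule minus_mult_distrib_mat[OF _ D R(1)]) simp
  also have "\<mu> \<cdot>\<^sub>m 1\<^sub>m n * R = \<mu> \<cdot>\<^sub>m R"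
    unfolding mult_smult_assoc_mat[OF one_carrier_mat R(1)] left_mult_one_mat[OF R(1)] ..
  finally have "1\<^sub>m n = \<mu> \<cdot>\<^sub>m R - D * R" using R(2) by simp
  then show "D * R = \<mu> \<cdot>\<^sub>m R - 1\<^sub>m n"
    using minus_minus_mat[OF smult_carrier_mat[OF R(1)] mult_carrier_mat[OF D R(1)], of \<mu>] by simp
qed

text \<open>
  \<open>Q\<close> commutes with \<open>D\<close>, hence with the resolvent \<open>R\<close>, so \<open>T\<close> can be carried through \<open>B R C\<close>
  from right to left: it becomes \<open>Q\<close> at \<open>C\<close> and \<open>T\<close> again at \<open>B\<close>.
\<close>

lemma reduction_commutes:
  fixes A B C D T Q R :: "complex mat"
  assumes A: "A \<in> carrier_mat s s" and B: "B \<in> carrier_mat s n" and C: "C \<in> carrier_mat n s"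
    and D: "D \<in> carrier_mat n n" and T: "T \<in> carrier_mat s s" and Q: "Q \<in> carrier_mat n n"
    and R: "R \<in> carrier_mat n n" "M * R = 1\<^sub>m n" "R * M = 1\<^sub>m n" and M: "M = \<mu> \<cdot>\<^sub>m 1\<^sub>m n - D"
    and com: "A * T = T * A" "B * Q = T * B" "Q * C = C * T" "Q * D = D * Q"
  shows "(A + B * R * C) * T = T * (A + B * R * C)"
proof -
  have Mc: "M \<in> carrier_mat n n" unfolding M using D by auto
  have QM: "Q * M = M * Q"
  proof -
    have "Q * M = Q * (\<mu> \<cdot>\<^sub>m 1\<^sub>m n) - Q * D"
      unfolding M by (rule mult_minus_distrib_mat[OF Q _ D]) simp
    also have "Q * (\<mu> \<cdot>\<^sub>m 1\<^sub>m n) = \<mu> \<cdot>\<^sub>m 1\<^sub>m n * Q"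
      unfolding mult_smult_distrib[OF Q one_carrier_mat] mult_smult_assoc_mat[OF one_carrier_mat Q]
      using Q by simp
    also have "\<mu> \<cdot>\<^sub>m 1\<^sub>m n * Q - Q * D = M * Q"
      unfolding M com(4) by (rule minus_mult_distrib_mat[symmetric, OF _ D Q]) simp
    finally show ?thesis .
  qed
  note d = carrier_matD[OF A] carrier_matD[OF B] carrier_matD[OF C] carrier_matD[OF T] carrier_matD[OF Q]
    carrier_matD[OF R(1)] carrier_matD[OF Mc]
  have "R * Q = R * Q * (M * R)" unfolding R(2) using R(1) Q by simp
  also have "\<dots> = R * (Q * M) * R" by (simp add: d mult_assoc_dim)
  also have "\<dots> = R * M * (Q * R)" unfolding QM by (simp add: d mult_assoc_dim)
  also have "\<dots> = Q * R" unfolding R(3) using R(1) Q by simp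
  finally have RQ: "R * Q = Q * R" .
  have BRC: "B * R * C \<in> carrier_mat s s" using B R C by simp
  have "B * R * C * T = B * R * (Q * C)" unfolding com(3) by (simp add: d mult_assoc_dim)
  also have "\<dots> = B * (R * Q) * C" by (simp add: d mult_assoc_dim)
  also have "\<dots> = B * Q * (R * C)" unfolding RQ by (simp add: d mult_assoc_dim)
  also have "\<dots> = T * (B * R * C)" unfolding com(2) by (simp add: d mult_assoc_dim)
  finally show ?thesis
    unfolding add_mult_distrib_mat[OF A BRC T] mult_add_distrib_mat[OF T A BRC] com(1) by simp
qed

section \<open>Equivalence of the commutation conditions\<close>

theorem theorem1:
  fixes N :: nat and H T :: "complex mat" and S S' :: "nat set"
  assumes "0 < N"
    and "H \<in> carrier_mat N N" and "self_adjoint_mat H"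
    and "S \<subseteq> {..<N}" and "S' = {..<N} - S"
    and "T \<in> carrier_mat (card S) (card S)" and "normal_mat T" and "invertible_mat T"
  shows "((\<forall>\<mu>. \<mu> \<notin> spectrum (submatrix H S' S') \<longrightarrow>
             mat_commutator (isospectral_reduction H S \<mu>) T = 0\<^sub>m (card S) (card S))
          \<longleftrightarrow>
          (\<forall>k::nat. mat_commutator (submatrix (H ^\<^sub>m k) S S) T = 0\<^sub>m (card S) (card S)))
       \<and> ((\<forall>k::nat. mat_commutator (submatrix (H ^\<^sub>m k) S S) T = 0\<^sub>m (card S) (card S))
          \<longleftrightarrow>
          (\<exists>Q Q'. Q \<in> carrier_mat N N \<and> Q' \<in> carrier_mat (card S') (card S') \<and>
             normal_mat Q \<and> is_direct_sum S Q T Q' \<and> mat_commutator Q H = 0\<^sub>m N N))"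
proof -
  note H = assms(2) and T = assms(6)
  let ?s = "card S" and ?n = "card S'"
  have S: "S \<subseteq> {..<N}" and S': "S' \<subseteq> {..<N}" using assms(4,5) by auto
  define A where "A = submatrix H S S"
  define B where "B = submatrix H S S'"
  define C where "C = submatrix H S' S"
  define D where "D = submatrix H S' S'"
  have A: "A \<in> carrier_mat ?s ?s" and B: "B \<in> carrier_mat ?s ?n"
    and C: "C \<in> carrier_mat ?n ?s" and D: "D \<in> carrier_mat ?n ?n"
    unfolding A_def B_def C_def D_def using submatrix_carrier[OF H] S S' by auto
  have Hadj: "mat_adjoint H = H" using assms(3) by (simp add: self_adjoint_mat_def)
  have CB: "C = mat_adjoint B" and DD: "mat_adjoint D = D"
    using submatrix_adjoint[OF H S' S] submatrix_adjoint[OF H S' S'] unfolding Hadj B_def C_def D_def by auto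
  let ?R = "\<lambda>\<mu>. the (mat_inverse (\<mu> \<cdot>\<^sub>m 1\<^sub>m ?n - D))"
  have red: "isospectral_reduction H S \<mu> = A + B * ?R \<mu> * C" for \<mu>
    using H unfolding isospectral_reduction_def Let_def co_index_def A_def B_def C_def D_def assms(5) by simp
  define moments where "moments \<longleftrightarrow> A * T = T * A \<and> (\<forall>k. B * D ^\<^sub>m k * C * T = T * (B * D ^\<^sub>m k * C))"
  have redc: "A + B * ?R \<mu> * C \<in> carrier_mat ?s ?s" if "\<mu> \<notin> spectrum D" for \<mu>
    using A B C mat_inverse_resolvent(1)[OF D that] by simp
  have i: "(\<forall>\<mu>. \<mu> \<notin> spectrum D \<longrightarrow> mat_commutator (isospectral_reduction H S \<mu>) T = 0\<^sub>m ?s ?s)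
      \<longleftrightarrow> (\<forall>\<mu>. \<mu> \<notin> spectrum D \<longrightarrow> (A + B * ?R \<mu> * C) * T = T * (A + B * ?R \<mu> * C))"
    (is "?i \<longleftrightarrow> ?i'")
    unfolding red using mat_commutator_eq_0_iff[OF redc T] by blast
  have Hk: "H ^\<^sub>m k \<in> carrier_mat N N" for k using H by simp
  have ii: "(\<forall>k. mat_commutator (submatrix (H ^\<^sub>m k) S S) T = 0\<^sub>m ?s ?s)
      \<longleftrightarrow> (\<forall>k. submatrix (H ^\<^sub>m k) S S * T = T * submatrix (H ^\<^sub>m k) S S)"
    (is "?ii \<longleftrightarrow> ?ii'")
    using mat_commutator_eq_0_iff[OF submatrix_carrier[OF Hk S S] T] by blast
  let ?iii = "\<exists>Q Q'. Q \<in> carrier_mat N N \<and> Q' \<in> carrier_mat (card S') (card S') \<and>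
             normal_mat Q \<and> is_direct_sum S Q T Q' \<and> mat_commutator Q H = 0\<^sub>m N N"
  have i_moments: moments if ?i'
  proof -
    have "infinite (- spectrum D)"
      using card_finite_spectrum(1)[OF D] infinite_UNIV_char_0 finite_compl by blast
    then show ?thesis
      unfolding moments_def
      using resolvent_moments_commute[OF A B C D T, of "- spectrum D" ?R]
        mat_inverse_resolvent[OF D] that by auto
  qed
  have ii_moments: moments if ?ii'
  proof -
    have S'_eq: "{..<N} - S = S'" using assms(5) by simp
    have zero: "submatrix (H ^\<^sub>m 0) S S = 1\<^sub>m ?s" "submatrix (H ^\<^sub>m 0) S S' = 0\<^sub>m ?s ?n"
      using H submatrix_one[OF S] submatrix_one_off_diagonal[OF S S'] assms(5) by auto
    note step = submatrix_mult[OF Hk H S _ S, unfolded S'_eq]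
    show ?thesis
      unfolding moments_def
      using power_blocks_moments_commute[OF A B C D T,
          of "\<lambda>k. submatrix (H ^\<^sub>m k) S S" "\<lambda>k. submatrix (H ^\<^sub>m k) S S'"]
        zero step[OF S] step[OF S'] that
      unfolding A_def B_def C_def D_def by simp
  qed
  have moments_iii: ?iii if mom: moments
  proof -
    obtain Q' where Q': "Q' \<in> carrier_mat ?n ?n" "normal_mat Q'" "Q' * D = D * Q'"
      "B * Q' = T * B" "Q' * C = C * T"
    proof -
      have "B * D ^\<^sub>m k * C * T = T * (B * D ^\<^sub>m k * C)" for k
        using mom by (simp add: moments_def)
      from commuting_extension_exists[OF D DD B CB T assms(7) this] show thesis
        using that by blast
    qed
    obtain Q where Q: "Q \<in> carrier_mat N N" and ds: "is_direct_sum S Q T Q'"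
      using direct_sum_exists[OF S T, of Q'] Q'(1) assms(5) by blast
    note mult = direct_sum_mult_blocks[OF Q H S _ ds, folded assms(5)]
    have "Q * H = H * Q"
    proof (rule block_mat_eqI[OF _ _ S, folded assms(5)])
      show "submatrix (Q * H) S S = submatrix (H * Q) S S"
        unfolding mult(1)[OF S] mult(3)[OF S] using mom by (simp add: moments_def A_def)
      show "submatrix (Q * H) S S' = submatrix (H * Q) S S'"
        unfolding mult(1)[OF S'] mult(4)[OF S] using Q'(4) by (simp add: B_def)
      show "submatrix (Q * H) S' S = submatrix (H * Q) S' S"
        unfolding mult(2)[OF S] mult(3)[OF S'] using Q'(5) by (simp add: C_def)
      show "submatrix (Q * H) S' S' = submatrix (H * Q) S' S'"
        unfolding mult(2)[OF S'] mult(4)[OF S'] using Q'(3) by (simp add: D_def)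
    qed (use Q H in auto)
    then have "mat_commutator Q H = 0\<^sub>m N N" using mat_commutator_eq_0_iff[OF Q H] by simp
    moreover have "normal_mat Q" by (rule normal_direct_sum[OF Q S ds assms(7) Q'(2)])
    ultimately show ?thesis using Q Q'(1) ds by blast
  qed
  have iii_i_ii: "?i' \<and> ?ii'" if iii: ?iii
  proof -
    obtain Q Q' where Q: "Q \<in> carrier_mat N N" and Q': "Q' \<in> carrier_mat ?n ?n"
      and ds: "is_direct_sum S Q T Q'" and "mat_commutator Q H = 0\<^sub>m N N"
      using iii by blast
    then have com: "Q * H = H * Q" using mat_commutator_eq_0_iff[OF Q H] by simp
    note mult = direct_sum_mult_blocks[OF Q H S _ ds, folded assms(5)]
    have AT: "A * T = T * A" using mult(1)[OF S] mult(3)[OF S] unfolding com A_def by simp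
    have BQ: "B * Q' = T * B" using mult(1)[OF S'] mult(4)[OF S] unfolding com B_def by simp
    have QC: "Q' * C = C * T" using mult(2)[OF S] mult(3)[OF S'] unfolding com C_def by simp
    have QD: "Q' * D = D * Q'" using mult(2)[OF S'] mult(4)[OF S'] unfolding com D_def by simp
    have ?i'
    proof (intro allI impI)
      fix \<mu> assume \<mu>: "\<mu> \<notin> spectrum D"
      note R = mat_inverse_resolvent(1-3)[OF D \<mu>]
      show "(A + B * ?R \<mu> * C) * T = T * (A + B * ?R \<mu> * C)"
        by (rule reduction_commutes[OF A B C D T Q' R refl AT BQ QC QD])
    qed
    moreover have ?ii'
    proof
      fix k
      have "Q * H ^\<^sub>m k = H ^\<^sub>m k * Q" by (rule pow_mat_commute[OF H Q com])
      then show "submatrix (H ^\<^sub>m k) S S * T = T * submatrix (H ^\<^sub>m k) S S"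
        using direct_sum_mult_blocks(1,3)[OF Q Hk S S ds] by metis
    qed
    ultimately show ?thesis ..
  qed
  show ?thesis
    unfolding D_def[symmetric] i ii using i_moments ii_moments moments_iii iii_i_ii by blast
qed

end
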